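(* Let $q$ be a prime power and $n$ a positive integer with $\gcd(n,q)=1$. Let $D$ be a $k$-dimensional cyclic code of length $n$ over $\mathbf{F}_q$ that is self-orthogonal, i.e. $D\subseteq D^\perp$. Let $T_D$ and $T_{D^\perp}$ denote the defining sets of $D$ and $D^\perp$, respectively. If $T$ is a subset of $T_D\setminus T_{D^\perp}$ that is a union of cyclotomic cosets, then one can define a cyclic code $C$ of length $n$ over $\mathbf{F}_q$ by the defining set $T_C=T_D\setminus(T\cup T^{-1})$. If $r=|T\cup T^{-1}|$ is in the range $0\le r<n-2k$, and $d=\min \mathrm{wt}(D^\perp\setminus C)$, then there exists a subsystem code with parameters $[[n,n-2k-r,r,d]]_q$.
   Context: Cyclic codes: a linear code $C\subseteq\mathbf{F}_q^n$ is cyclic if it is closed under cyclic shifts; identify $(c_0,\dots,c_{n-1})$ with $c_0+c_1x+\cdots+c_{n-1}x^{n-1}$ in $\mathbf{F}_q[x]/(x^n-1)$, so that a cyclic code is an ideal generated by a unique monic divisor $g(x)$ of $x^n-1$. Fix a primitive $n$-th root of unity $\alpha$ over $\mathbf{F}_q$. The defining set of $C$ is the set $T\subseteq N=\{0,\dots,n-1\}$ with $g(x)=\prod_{t\in T}(x-\alpha^t)$; it is a union of cyclotomic cosets $C_x=\{xq^i\bmod n : i\ge 0\}$, and $\dim C=n-|T|$. For an integer $a$, $T^a=\{at\bmod n : t\in T\}$. $D^\perp$ is the Euclidean dual with respect to $\sum_i x_iy_i$. $\mathrm{wt}(S)$ is the minimum Hamming weight of the nonzero vectors in $S$. Subsystem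 codes: let $p$ be the characteristic of $\mathbf{F}_q$. For $(x|y)\in\mathbf{F}_q^{2n}$ (with $x,y\in\mathbf{F}_q^n$), $\mathrm{swt}(x|y)$ is the number of $i$ with $(x_i,y_i)\ne(0,0)$, and $\mathrm{swt}(S)$ is the minimum of $\mathrm{swt}$ over the nonzero elements of $S$. The trace-symplectic product of $(a|b)$ and $(a'|b')$ is $\mathrm{tr}_{q/p}(a'\cdot b-a\cdot b')$, and $X^{\perp_s}$ is the dual of $X\subseteq\mathbf{F}_q^{2n}$ with respect to it. All subsystem codes are Clifford subsystem codes: an $((n,K,R,d))_q$ subsystem code is a subspace $Q=A\otimes B$ of $\mathbf{C}^{q^n}$, $\dim A=K$, $\dim B=R$, arising from an additive code; concretely, its existence means that there is an additive subgroup $X\le\mathbf{F}_q^{2n}$ (the zero code is allowed) with $Y=X\cap X^{\perp_s}$ such that $|X|=q^nR/K$, $|Y|=q^n/(KR)$, and $d=\mathrm{swt}(Y^{\perp_s}\setminus X)$ if $Y^{\perp_s}\ne X$, while $d=\mathrm{swt}(Y^{\perp_s})$ if $Y^{\perp_s}=X$ (the case $K=1$). $[[n,k,r,d]]_q$ means $((n,q^k,q^r,d))_q$. *)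

theory Defs
  imports
    "HOL-Algebra.Algebraic_Closure_Type"
    "Jordan_Normal_Form.VS_Connect"
    "HOL-Library.Cardinality"
begin

section \<open>Linear and cyclic codes\<close>

definition linear_code :: "nat \<Rightarrow> 'a::field vec set \<Rightarrow> bool" where
  "linear_code n C \<longleftrightarrow> VectorSpace.subspace class_ring C (module_vec TYPE('a) n)"

definition code_dim :: "nat \<Rightarrow> 'a::field vec set \<Rightarrow> nat" where
  "code_dim n C = vectorspace.dim class_ring ((module_vec TYPE('a) n)\<lparr>carrier := C\<rparr>)"

text \<open>The shift sends $(c_0,\dots,c_{n-1})$ to $(c_{n-1},c_0,\dots,c_{n-2})$.\<close>

definition cyclic_shift :: "nat \<Rightarrow> 'a vec \<Rightarrow> 'a vec" where
  "cyclic_shift n v = vec n (\<lambda>i. v $ ((i + n - 1) mod n))"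

definition cyclic_code :: "nat \<Rightarrow> 'a::field vec set \<Rightarrow> bool" where
  "cyclic_code n C \<longleftrightarrow> linear_code n C \<and> (\<forall>v\<in>C. cyclic_shift n v \<in> C)"

definition dual_code :: "nat \<Rightarrow> 'a::field vec set \<Rightarrow> 'a vec set" where
  "dual_code n D = {v \<in> carrier_vec n. \<forall>u\<in>D. u \<bullet> v = 0}"

definition hamming_weight :: "'a::zero vec \<Rightarrow> nat" where
  "hamming_weight v = card {i. i < dim_vec v \<and> v $ i \<noteq> 0}"

definition min_weight :: "'a::zero vec set \<Rightarrow> nat" where
  "min_weight S = Min (hamming_weight ` {v \<in> S. v \<noteq> 0\<^sub>v (dim_vec v)})"

section \<open>Generator polynomials and defining sets\<close>

definition code_poly :: "'a::field vec \<Rightarrow> 'a poly" where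
  "code_poly v = Poly (list_of_vec v)"

text \<open>Residue classes modulo $x^n-1$ are represented by their remainders, so the second
  conjunct is equality of $C$ with the ideal generated by $g$.\<close>

definition generates_code :: "nat \<Rightarrow> 'a::field poly \<Rightarrow> 'a vec set \<Rightarrow> bool" where
  "generates_code n g C \<longleftrightarrow>
     C \<subseteq> carrier_vec n \<and>
     code_poly ` C = {(f * g) mod (Polynomial.monom 1 n - 1) | f. True}"

definition generator_poly :: "nat \<Rightarrow> 'a::field vec set \<Rightarrow> 'a poly" where
  "generator_poly n C = (THE g.
     Polynomial.lead_coeff g = 1 \<and> g dvd Polynomial.monom 1 n - 1 \<and> generates_code n g C)"

definition primitive_root_of_unity :: "nat \<Rightarrow> 'a::field \<Rightarrow> bool" where
  "primitive_root_of_unity n \<alpha> \<longleftrightarrow> \<alpha> ^ n = 1 \<and> (\<forall>m. 0 < m \<and> m < n \<longrightarrow> \<alpha> ^ m \<noteq> 1)"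

definition defining_set :: "nat \<Rightarrow> 'a::field alg_closure \<Rightarrow> 'a vec set \<Rightarrow> nat set" where
  "defining_set n \<alpha> C = (THE T.
     T \<subseteq> {..<n} \<and> map_poly to_ac (generator_poly n C) = (\<Prod>t\<in>T. [:- (\<alpha> ^ t), 1:]))"

definition cyclotomic_coset :: "nat \<Rightarrow> nat \<Rightarrow> nat \<Rightarrow> nat set" where
  "cyclotomic_coset q n x = {x * q ^ i mod n | i. True}"

definition union_of_cosets :: "nat \<Rightarrow> nat \<Rightarrow> nat set \<Rightarrow> bool" where
  "union_of_cosets q n T \<longleftrightarrow> (\<exists>S\<subseteq>{..<n}. T = (\<Union>x\<in>S. cyclotomic_coset q n x))"

text \<open>The set $T^a=\{at \bmod n : t\in T\}$, where $a$ may be negative.\<close>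

definition set_multiple :: "nat \<Rightarrow> int \<Rightarrow> nat set \<Rightarrow> nat set" where
  "set_multiple n a T = (\<lambda>t. nat ((a * int t) mod int n)) ` T"

section \<open>Subsystem codes\<close>

text \<open>The trace to the prime field, $x + x^p + \dots + x^{p^{m-1}}$ for $q = p^m$. Its values are
  kept inside the large field; $m$ is recovered as the multiplicity of $p$ in
  $q$.\<close>

definition prime_trace :: "'a::finite_field \<Rightarrow> 'a" where
  "prime_trace x = (\<Sum>i < multiplicity CHAR('a) CARD('a). x ^ (CHAR('a) ^ i))"

text \<open>An element $(x|y)$ of $\mathbf{F}_q^{2n}$ is represented by the pair of its halves.\<close>

definition trace_symplectic :: "'a::finite_field vec \<times> 'a vec \<Rightarrow> 'a vec \<times> 'a vec \<Rightarrow> 'a" where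
  "trace_symplectic u v = prime_trace (fst v \<bullet> snd u - fst u \<bullet> snd v)"

definition symplectic_dual ::
  "nat \<Rightarrow> ('a::finite_field vec \<times> 'a vec) set \<Rightarrow> ('a vec \<times> 'a vec) set" where
  "symplectic_dual n U =
     {v \<in> carrier_vec n \<times> carrier_vec n. \<forall>u\<in>U. trace_symplectic u v = 0}"

definition symplectic_weight :: "'a::zero vec \<times> 'a vec \<Rightarrow> nat" where
  "symplectic_weight v = card {i. i < dim_vec (fst v) \<and> (fst v $ i, snd v $ i) \<noteq> (0, 0)}"

definition min_symplectic_weight :: "nat \<Rightarrow> ('a::zero vec \<times> 'a vec) set \<Rightarrow> nat" where
  "min_symplectic_weight n S = Min (symplectic_weight ` (S - {(0\<^sub>v n, 0\<^sub>v n)}))"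

text \<open>Existence of an $((n,K,R,d))_q$ Clifford subsystem code, expressed through the additive
  code $U$ from which it arises (often written $X$, a token taken by HOL-Algebra). The group
  is the product of two copies of the additive group of $\mathbf{F}_q^n$.\<close>

definition subsystem_code_exists ::
  "'a::finite_field itself \<Rightarrow> nat \<Rightarrow> nat \<Rightarrow> nat \<Rightarrow> nat \<Rightarrow> bool" where
  "subsystem_code_exists _ n K R d \<longleftrightarrow>
     0 < K \<and> 0 < R \<and>
     (\<exists>U :: ('a vec \<times> 'a vec) set.
        subgroup U (monoid_vec TYPE('a) n \<times>\<times> monoid_vec TYPE('a) n) \<and>
        (let W = U \<inter> symplectic_dual n U in
           real (card U) = real (CARD('a) ^ n * R) / real K \<and>
           real (card W) = real (CARD('a) ^ n) / real (K * R) \<and>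
           d = (if symplectic_dual n W = U
                then min_symplectic_weight n (symplectic_dual n W)
                else min_symplectic_weight n (symplectic_dual n W - U))))"

definition subsystem_code_nkrd ::
  "'a::finite_field itself \<Rightarrow> nat \<Rightarrow> nat \<Rightarrow> nat \<Rightarrow> nat \<Rightarrow> bool" where
  "subsystem_code_nkrd F n k r d \<longleftrightarrow>
     subsystem_code_exists F n (CARD('a) ^ k) (CARD('a) ^ r) d"

end

theory Submission
  imports
    Defs
    "Jordan_Normal_Form.Char_Poly"
    "HOL-Algebra.Sylow"
    "HOL-Number_Theory.Cong"
begin

text \<open>
  A cyclic code is determined by its defining set \<open>S\<close>: it consists of the vectors whose
  discrete Fourier transform (over the algebraic closure) vanishes on \<open>S\<close>, and every union of
  cyclotomic cosets arises as such an \<open>S\<close>. Intersecting codes unites defining sets, and the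
  dual has defining set \<open>{t. -t \<notin> S}\<close>. As \<open>T \<union> T\<^sup>-\<^sup>1\<close> is symmetric, lies in
  \<open>T_D\<close>, and the defining set of \<open>D\<^sup>\<bottom>\<close> lies in \<open>T_D\<close> by self-orthogonality, the code
  \<open>C\<close> with defining set \<open>T_D - (T \<union> T\<^sup>-\<^sup>1)\<close> satisfies \<open>C \<inter> C\<^sup>\<bottom> = D\<close>. The additive code
  \<open>C \<times> C\<close> then yields the subsystem code, because the trace form is nondegenerate and hence
  \<open>(C \<times> C)\<^sup>\<bottom>\<^sup>s = C\<^sup>\<bottom> \<times> C\<^sup>\<bottom>\<close>.
\<close>

section \<open>Finite fields and their Frobenius endomorphism\<close>

text \<open>If a prime \<open>r\<close> divided the part of the order prime to the characteristic,
  the additive group would contain an element of order \<open>r\<close>. Then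
  \<open>of_nat r\<close> would annihilate a nonzero field element, which forces \<open>r\<close> to
  be the characteristic.\<close>

lemma CARD_finite_field_eq_CHAR_power:
  "CARD('a::finite_field) = CHAR('a) ^ multiplicity CHAR('a) CARD('a)"
proof -
  let ?p = "CHAR('a)"
  have p: "prime ?p"
    by (rule prime_CHAR_semidom) (rule CHAR_pos)
  have pos: "CARD('a) > 0"
    by simp
  obtain s where s: "CARD('a) = ?p ^ multiplicity ?p CARD('a) * s" "\<not> ?p dvd s"
    using multiplicity_decompose'[of "CARD('a)" ?p] pos p
    by (metis not_prime_unit neq0_conv mult.commute)
  have "s = 1"
  proof (rule ccontr)
    assume "s \<noteq> 1"
    then obtain r where r: "prime r" "r dvd s"
      using prime_factor_nat by blast
    then obtain m where m: "CARD('a) = r ^ 1 * m"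
      using s(1) by (metis dvd_def dvd_mult power_one_right)
    define G where "G = \<lparr>carrier = (UNIV :: 'a set), monoid.mult = (+), one = (0 :: 'a)\<rparr>"
    have grp: "group G"
    proof (rule groupI)
      show "\<exists>y\<in>carrier G. y \<otimes>\<^bsub>G\<^esub> x = \<one>\<^bsub>G\<^esub>" for x
        by (auto simp: G_def intro: exI[of _ "- x"])
    qed (auto simp: G_def add_ac)
    then interpret group G .
    have pow: "x [^]\<^bsub>G\<^esub> (k::nat) = of_nat k * x" for x k
      by (induction k) (auto simp: nat_pow_def G_def algebra_simps)
    \<comment> \<open>With exponent 1, Sylow's theorem serves as Cauchy's theorem.\<close>
    obtain H where H: "subgroup H G" "card H = r ^ 1"
      using sylow_thm[OF r(1) grp, of 1 m] m by (auto simp: G_def Coset.order_def)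
    have "card H \<ge> 2"
      using H(2) prime_ge_2_nat[OF r(1)] by simp
    then obtain x where x: "x \<in> H" "x \<noteq> 0"
      using card_mono[of "{0}" H] by (cases "H \<subseteq> {0}") auto
    interpret HG: group "G\<lparr>carrier := H\<rparr>"
      using subgroup.subgroup_is_group[OF H(1) grp] .
    have "x [^]\<^bsub>G\<lparr>carrier := H\<rparr>\<^esub> r = \<one>\<^bsub>G\<lparr>carrier := H\<rparr>\<^esub>"
      using HG.pow_order_eq_1[of x] x H by (simp add: Coset.order_def)
    hence "of_nat r * x = 0"
      using pow[of x r] by (simp add: G_def nat_pow_def)
    hence "?p dvd r"
      using x(2) by (auto simp: of_nat_eq_0_iff_char_dvd)
    with p r(1) have "?p = r"
      using primes_dvd_imp_eq by blast
    with r(2) s(2) show False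
      by simp
  qed
  with s(1) show ?thesis
    by simp
qed

lemma multiplicity_CHAR_CARD_pos: "multiplicity CHAR('a) CARD('a::finite_field) > 0"
proof (rule ccontr)
  assume "\<not> ?thesis"
  hence "CARD('a) = 1"
    using CARD_finite_field_eq_CHAR_power[where 'a='a] by simp
  moreover have "card {0, 1 :: 'a} \<le> CARD('a)"
    by (rule card_mono) auto
  ultimately show False
    by simp
qed

lemma CARD_finite_field_gt_1: "CARD('a::finite_field) > 1"
proof -
  have "card {0, 1 :: 'a} \<le> CARD('a)"
    by (rule card_mono) auto
  thus ?thesis
    by simp
qed

lemma frobenius_add:
  fixes x y :: "'a::finite_field alg_closure"
  shows "(x + y) ^ CARD('a) = x ^ CARD('a) + y ^ CARD('a)"
proof (rule freshmans_dream')
  show "prime CHAR('a alg_closure)"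
    by (simp add: prime_CHAR_semidom)
  show "CARD('a) = CHAR('a alg_closure) ^ multiplicity CHAR('a) CARD('a)"
    using CARD_finite_field_eq_CHAR_power by simp
qed

interpretation to_ac_hom: field_hom "to_ac :: 'a::field \<Rightarrow> 'a alg_closure"
  by unfold_locales auto

interpretation to_ac_poly:
  map_poly_inj_idom_divide_hom "to_ac :: 'a::field \<Rightarrow> 'a alg_closure" ..

interpretation frobenius_hom:
  idom_hom "\<lambda>x :: 'a::finite_field alg_closure. x ^ CARD('a)"
  by unfold_locales (auto simp: frobenius_add power_mult_distrib power_0_left)

interpretation frobenius_poly:
  map_poly_idom_hom "\<lambda>x :: 'a::finite_field alg_closure. x ^ CARD('a)" ..

text \<open>The fixed points are the roots of X^q - X. There are at most q of them, and the embedded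
  base field already supplies q.\<close>

lemma frobenius_fixed_iff:
  fixes x :: "'a::finite_field alg_closure"
  shows "x ^ CARD('a) = x \<longleftrightarrow> x \<in> range to_ac"
proof
  assume x: "x ^ CARD('a) = x"
  define P :: "'a alg_closure poly" where
    "P = Polynomial.monom 1 CARD('a) - Polynomial.monom 1 1"
  have "Polynomial.coeff P CARD('a) = 1"
    using CARD_finite_field_gt_1[where 'a='a] by (simp add: P_def)
  hence P0: "P \<noteq> 0"
    by auto
  have "Polynomial.degree P \<le> CARD('a)"
    unfolding P_def by (intro degree_diff_le degree_monom_le order.trans[OF degree_monom_le]) simp_all
  moreover have "card {z. poly P z = 0} \<le> Polynomial.degree P"
    using card_poly_roots_bound[OF P0] .
  moreover have "range to_ac \<subseteq> {z. poly P z = 0}"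
    by (auto simp: P_def poly_monom finite_field_power_card_eq_same simp flip: to_ac_power)
  moreover have "card (range to_ac :: 'a alg_closure set) = CARD('a)"
    by (rule card_image) (rule inj_to_ac)
  ultimately have "range to_ac = {z. poly P z = 0}"
    using poly_roots_finite[OF P0] by (intro card_subset_eq card_seteq) auto
  moreover have "poly P x = 0"
    using x by (simp add: P_def poly_monom)
  ultimately show "x \<in> range to_ac"
    by simp
qed (auto simp: finite_field_power_card_eq_same simp flip: to_ac_power)

text \<open>Galois descent, coefficient by coefficient: what Frobenius fixes comes from the base
  field.\<close>

lemma frobenius_fixed_poly_descends:
  fixes f :: "'a::finite_field alg_closure poly"
  assumes "map_poly (\<lambda>x. x ^ CARD('a)) f = f"
  obtains f0 where "map_poly to_ac f0 = f"
proof
  show "map_poly to_ac (map_poly of_ac f) = f"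
  proof (rule poly_eqI)
    fix i
    have "Polynomial.coeff f i ^ CARD('a) = Polynomial.coeff f i"
      using arg_cong[OF assms, of "\<lambda>p. Polynomial.coeff p i"] by (simp add: coeff_map_poly)
    thus "Polynomial.coeff (map_poly to_ac (map_poly of_ac f)) i = Polynomial.coeff f i"
      by (simp add: coeff_map_poly to_ac_of_ac frobenius_fixed_iff)
  qed
qed

section \<open>The trace to the prime field\<close>

lemma prime_trace_0 [simp]: "prime_trace (0::'a::finite_field) = 0"
  by (simp add: prime_trace_def power_0_left)

text \<open>As a polynomial, the trace is nonzero of degree at most q/p, so it cannot vanish at all
  q field elements. This is the source of nondegeneracy of the trace-symplectic form.\<close>

lemma prime_trace_nonzero:
  obtains a :: "'a::finite_field" where "prime_trace a \<noteq> 0"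
proof -
  let ?p = "CHAR('a)" and ?m = "multiplicity CHAR('a) CARD('a)"
  define P :: "'a poly" where "P = (\<Sum>i<?m. Polynomial.monom 1 (?p ^ i))"
  have p: "?p > 1"
    using prime_CHAR_semidom[where 'a='a] CHAR_pos prime_gt_1_nat by blast
  have eval: "poly P a = prime_trace a" for a
    by (simp add: P_def prime_trace_def poly_sum poly_monom)
  \<comment> \<open>Since p > 1, only the summand with \<open>i = 0\<close> contributes to the
    linear coefficient.\<close>
  have "Polynomial.coeff P 1 = (\<Sum>i<?m. if i = 0 then 1 else 0)"
    unfolding P_def coeff_sum using p by (intro sum.cong) auto
  hence "Polynomial.coeff P 1 = 1"
    using multiplicity_CHAR_CARD_pos[where 'a='a] by simp
  hence P0: "P \<noteq> 0"
    by auto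
  have "Polynomial.degree P \<le> ?p ^ (?m - 1)"
    unfolding P_def
  proof (rule degree_sum_le)
    fix i assume "i \<in> {..<?m}"
    thus "Polynomial.degree (Polynomial.monom (1::'a) (?p ^ i)) \<le> ?p ^ (?m - 1)"
      using p by (intro order.trans[OF degree_monom_le] power_increasing) auto
  qed simp
  also have "\<dots> < ?p ^ ?m"
    using p multiplicity_CHAR_CARD_pos[where 'a='a] by (intro power_strict_increasing) auto
  also have "\<dots> = CARD('a)"
    using CARD_finite_field_eq_CHAR_power[where 'a='a] by simp
  finally have "card {a. poly P a = 0} < CARD('a)"
    using card_poly_roots_bound[OF P0] by simp
  hence "{a. poly P a = 0} \<noteq> UNIV"
    by auto
  thus ?thesis
    using that eval by auto
qed

section \<open>Generator polynomials\<close>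

lemma coeff_code_poly:
  "Polynomial.coeff (code_poly v) i = (if i < dim_vec v then v $ i else 0)"
  by (auto simp: code_poly_def nth_default_def)

lemma degree_code_poly:
  assumes "v \<in> carrier_vec n" "n > 0"
  shows "Polynomial.degree (code_poly v) < n"
  using assms by (intro degree_lessI) (auto simp: coeff_code_poly)

lemma vec_coeff_code_poly:
  "v \<in> carrier_vec n \<Longrightarrow> vec n (Polynomial.coeff (code_poly v)) = v"
  by (auto simp: coeff_code_poly)

lemma code_poly_vec_coeff:
  assumes "Polynomial.degree p < n"
  shows "code_poly (vec n (Polynomial.coeff p)) = p"
  using assms by (auto simp: poly_eq_iff coeff_code_poly coeff_eq_0)

lemma code_poly_image_carrier:
  assumes "n > 0"
  shows "code_poly ` carrier_vec n = {p. Polynomial.degree p < n}"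
proof (intro equalityI subsetI)
  fix p :: "'a poly" assume "p \<in> {p. Polynomial.degree p < n}"
  thus "p \<in> code_poly ` carrier_vec n"
    by (intro image_eqI[of _ _ "vec n (Polynomial.coeff p)"]) (auto simp: code_poly_vec_coeff)
qed (use assms degree_code_poly in auto)

lemma inj_on_code_poly: "inj_on code_poly (carrier_vec n)"
  by (rule inj_on_inverseI[of _ "\<lambda>p. vec n (Polynomial.coeff p)"]) (rule vec_coeff_code_poly)

lemma code_poly_0 [simp]: "code_poly (0\<^sub>v n) = 0"
  by (auto simp: poly_eq_iff coeff_code_poly)

lemma code_poly_add:
  "u \<in> carrier_vec n \<Longrightarrow> v \<in> carrier_vec n \<Longrightarrow> code_poly (u + v) = code_poly u + code_poly v"
  by (auto simp: poly_eq_iff coeff_code_poly)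

lemma code_poly_smult: "code_poly (c \<cdot>\<^sub>v v) = Polynomial.smult c (code_poly v)"
  by (auto simp: poly_eq_iff coeff_code_poly)

text \<open>Multiplication by x pushes the last coordinate to degree n. Removing that multiple of
  x^n - 1 brings it back as the constant term, so the shift is multiplication by x modulo x^n -
  1.\<close>

lemma code_poly_cyclic_shift:
  assumes "v \<in> carrier_vec n" "n > 0"
  shows "pCons 0 (code_poly v) =
    code_poly (cyclic_shift n v) + Polynomial.smult (v $ (n - 1)) (Polynomial.monom 1 n - 1)"
proof (rule poly_eqI)
  fix i
  consider "i = 0" | "0 < i" "i < n" | "i = n" | "i > n"
    by linarith
  thus "Polynomial.coeff (pCons 0 (code_poly v)) i = Polynomial.coeff (code_poly (cyclic_shift n v)
      + Polynomial.smult (v $ (n - 1)) (Polynomial.monom 1 n - 1)) i"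
  proof cases
    case 2
    hence "(i + n - 1) mod n = i - 1"
      by (metis Nat.add_diff_assoc2 One_nat_def Suc_leI add.commute less_imp_diff_less mod_add_self1 mod_less)
    with 2 assms show ?thesis
      by (auto simp: coeff_code_poly cyclic_shift_def coeff_pCons split: nat.splits)
  qed (use assms in \<open>auto simp: coeff_code_poly cyclic_shift_def coeff_pCons split: nat.splits\<close>)
qed

lemma degree_monom_minus_1:
  "n > 0 \<Longrightarrow> Polynomial.degree (Polynomial.monom 1 n - 1 :: 'a::field poly) = n"
  by (intro antisym degree_diff_le le_degree) (auto simp: degree_monom_eq)

lemma monom_minus_1_neq_0: "n > 0 \<Longrightarrow> (Polynomial.monom 1 n - 1 :: 'a::field poly) \<noteq> 0"
  using degree_monom_minus_1[of n] by (metis degree_0 less_numeral_extra(3))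

lemma lead_coeff_monom_minus_1:
  "n > 0 \<Longrightarrow> Polynomial.lead_coeff (Polynomial.monom 1 n - 1 :: 'a::field poly) = 1"
  by (simp add: degree_monom_minus_1)

lemma monic_dvd_degree_eq:
  fixes f g :: "'a::field poly"
  assumes "f dvd g" "Polynomial.degree g \<le> Polynomial.degree f"
    and "Polynomial.lead_coeff f = 1" "Polynomial.lead_coeff g = 1"
  shows "f = g"
proof -
  obtain h where h: "g = f * h"
    using assms(1) by blast
  have nz: "f \<noteq> 0" "h \<noteq> 0"
    using assms h by auto
  hence "Polynomial.degree h = 0"
    using h assms(2) by (simp add: degree_mult_eq)
  then obtain c where c: "h = [:c:]"
    using degree_eq_zeroE by blast
  moreover from this h nz have "c \<noteq> 0"
    by auto
  ultimately have "c = 1"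
    using h assms(3,4) by simp
  with h c show ?thesis
    by simp
qed

lemma monic_dvd_antisym:
  fixes f g :: "'a::field poly"
  assumes "f dvd g" "g dvd f" "Polynomial.lead_coeff f = 1" "Polynomial.lead_coeff g = 1"
  shows "f = g"
proof (rule monic_dvd_degree_eq)
  have "f \<noteq> 0"
    using assms(3) by auto
  thus "Polynomial.degree g \<le> Polynomial.degree f"
    using assms(2) by (rule dvd_imp_degree_le[rotated])
qed (use assms in auto)

text \<open>As \<open>g\<close> divides x^n - 1, reduction preserves divisibility by
  \<open>g\<close>. The remainders of multiples of \<open>g\<close> are therefore its multiples of
  degree below n.\<close>

lemma generates_code_iff:
  assumes n: "n > 0" and g: "g dvd Polynomial.monom 1 n - 1"
  shows "generates_code n g C \<longleftrightarrow> C = {v \<in> carrier_vec n. g dvd code_poly v}"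
proof -
  let ?M = "Polynomial.monom 1 n - 1 :: 'a poly"
  let ?Z = "{v \<in> carrier_vec n. g dvd code_poly v}"
  have "{(f * g) mod ?M | f. True} = {p. Polynomial.degree p < n \<and> g dvd p}"
  proof (intro equalityI subsetI; clarify?)
    fix f
    show "Polynomial.degree (f * g mod ?M) < n \<and> g dvd f * g mod ?M"
      using degree_mod_less'[of ?M "f * g"] n g degree_monom_minus_1[OF n, where 'a='a]
        monom_minus_1_neq_0[OF n, where 'a='a]
      by (cases "f * g mod ?M = 0") (auto simp: dvd_mod)
  next
    fix p assume p: "Polynomial.degree p < n" "g dvd p"
    then obtain f where "p = f * g"
      by (metis dvd_def mult.commute)
    moreover have "p mod ?M = p"
      using p(1) degree_monom_minus_1[OF n, where 'a='a] by (simp add: mod_poly_less)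
    ultimately show "\<exists>f. p = f * g mod ?M \<and> True"
      by metis
  qed
  also have "\<dots> = code_poly ` ?Z"
    using code_poly_image_carrier[OF n, where 'a='a] by auto
  finally have "generates_code n g C \<longleftrightarrow>
      C \<subseteq> carrier_vec n \<and> code_poly ` C = code_poly ` ?Z"
    by (simp add: generates_code_def)
  also have "\<dots> \<longleftrightarrow> C = ?Z"
    using inj_on_image_eq_iff[OF inj_on_code_poly, of C n ?Z] by auto
  finally show ?thesis .
qed

text \<open>Resolves the definite description: the code determines all multiples of its generator,
  so two monic candidates divide each other.\<close>

lemma generator_poly_eqI:
  assumes n: "n > 0" and g: "Polynomial.lead_coeff g = 1" "g dvd Polynomial.monom 1 n - 1"
    and C: "C = {v \<in> carrier_vec n. g dvd code_poly v}"
  shows "generator_poly n C = g"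
  unfolding generator_poly_def
proof (rule the_equality)
  show "Polynomial.lead_coeff g = 1 \<and> g dvd Polynomial.monom 1 n - 1 \<and> generates_code n g C"
    using generates_code_iff[OF n g(2)] g C by simp
next
  let ?M = "Polynomial.monom 1 n - 1 :: 'a poly"
  fix h assume h: "Polynomial.lead_coeff h = 1 \<and> h dvd ?M \<and> generates_code n h C"
  hence hC: "C = {v \<in> carrier_vec n. h dvd code_poly v}"
    using generates_code_iff[OF n] by blast
  \<comment> \<open>Testing the remainder instead of \<open>p\<close> also covers degree n, which
    the generator of the zero code has.\<close>
  have "f dvd p \<longleftrightarrow> (\<exists>v\<in>C. code_poly v = p mod ?M)"
    if "f dvd ?M" "C = {v \<in> carrier_vec n. f dvd code_poly v}" for f p
  proof -
    have "Polynomial.degree (p mod ?M) < n"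
      using degree_mod_less'[of ?M p] n degree_monom_minus_1[OF n, where 'a='a]
        monom_minus_1_neq_0[OF n, where 'a='a]
      by (cases "p mod ?M = 0") auto
    hence "code_poly (vec n (Polynomial.coeff (p mod ?M))) = p mod ?M"
      by (rule code_poly_vec_coeff)
    hence "(\<exists>v\<in>C. code_poly v = p mod ?M) \<longleftrightarrow> f dvd p mod ?M"
      using that(2) by force
    also have "\<dots> \<longleftrightarrow> f dvd p"
      using that(1) by (rule dvd_mod_iff)
    finally show ?thesis ..
  qed
  from this[of g] this[of h] have same_multiples: "g dvd p \<longleftrightarrow> h dvd p" for p
    using g(2) C h hC by blast
  have "h dvd g" "g dvd h"
    using same_multiples[of g] same_multiples[of h] by simp_all
  thus "h = g"
    using g(1) h by (intro monic_dvd_antisym) simp_all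
qed

text \<open>Divide with remainder by a nonzero element of least degree, scaled to be monic.\<close>

lemma poly_ideal_principal:
  fixes J :: "'a::field poly set"
  assumes add: "\<And>f g. f \<in> J \<Longrightarrow> g \<in> J \<Longrightarrow> f + g \<in> J"
    and mult: "\<And>f h. f \<in> J \<Longrightarrow> h * f \<in> J"
    and ne: "f0 \<in> J" "f0 \<noteq> 0"
  obtains g where "Polynomial.lead_coeff g = 1" "\<And>f. f \<in> J \<longleftrightarrow> g dvd f"
proof -
  obtain g0 where g0: "g0 \<in> J" "g0 \<noteq> 0"
    and min: "\<And>f. f \<in> J \<Longrightarrow> f \<noteq> 0 \<Longrightarrow> Polynomial.degree g0 \<le> Polynomial.degree f"
    using ex_has_least_nat[of "\<lambda>f. f \<in> J \<and> f \<noteq> 0" f0 Polynomial.degree] ne by blast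
  define g where "g = [:inverse (Polynomial.lead_coeff g0):] * g0"
  have deg: "Polynomial.degree g = Polynomial.degree g0"
    using g0 by (simp add: g_def)
  have gJ: "g \<in> J"
    unfolding g_def by (rule mult) (rule g0)
  have "g \<noteq> 0"
    using g0 by (simp add: g_def)
  show ?thesis
  proof
    show "Polynomial.lead_coeff g = 1"
      using g0 by (simp add: g_def)
    show "f \<in> J \<longleftrightarrow> g dvd f" for f
    proof
      assume "f \<in> J"
      have "f mod g = f + (- (f div g)) * g"
        by (simp add: minus_div_mult_eq_mod[symmetric])
      also have "\<dots> \<in> J"
        by (intro add mult gJ \<open>f \<in> J\<close>)
      finally have "f mod g \<in> J" .
      hence "f mod g = 0"
        using min[of "f mod g"] degree_mod_less'[of g f] \<open>g \<noteq> 0\<close> deg by fastforce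
      thus "g dvd f"
        by (rule mod_0_imp_dvd)
    next
      assume "g dvd f"
      thus "f \<in> J"
        using mult[OF gJ] by (metis dvd_def mult.commute)
    qed
  qed
qed

lemma linear_code_iff:
  fixes C :: "'a::field vec set"
  shows "linear_code n C \<longleftrightarrow> C \<subseteq> carrier_vec n \<and> 0\<^sub>v n \<in> C \<and>
    (\<forall>u\<in>C. \<forall>v\<in>C. u + v \<in> C) \<and> (\<forall>c. \<forall>v\<in>C. c \<cdot>\<^sub>v v \<in> C)"
  unfolding linear_code_def VectorSpace.subspace_def submodule_def
  using vec_vs[of n, where 'a='a] vec_module[of n, where 'a='a]
  by (auto simp: module_vec_simps)

text \<open>The preimage \<open>J\<close> of the code under reduction modulo x^n - 1 is an ideal of
  the polynomial ring; its monic generator generates the code. Cyclicity supplies closure under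
  multiplication by x.\<close>

lemma cyclic_code_generator:
  assumes n: "n > 0" and C: "cyclic_code n C"
  obtains g where "Polynomial.lead_coeff g = 1" "g dvd Polynomial.monom 1 n - 1"
    "C = {v \<in> carrier_vec n. g dvd code_poly v}"
proof -
  let ?M = "Polynomial.monom 1 n - 1 :: 'a poly"
  define J where "J = {f. f mod ?M \<in> code_poly ` C}"
  have lin: "C \<subseteq> carrier_vec n" "0\<^sub>v n \<in> C" "\<And>u v. u \<in> C \<Longrightarrow> v \<in> C \<Longrightarrow> u + v \<in> C"
    "\<And>c v. v \<in> C \<Longrightarrow> c \<cdot>\<^sub>v v \<in> C" and shift: "\<And>v. v \<in> C \<Longrightarrow> cyclic_shift n v \<in> C"
    using C by (auto simp: cyclic_code_def linear_code_iff)
  have mod_code: "code_poly v mod ?M = code_poly v" if "v \<in> carrier_vec n" for v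
    using degree_code_poly[OF that n] degree_monom_minus_1[OF n, where 'a='a]
    by (simp add: mod_poly_less)
  have add: "f + h \<in> J" if "f \<in> J" "h \<in> J" for f h
  proof -
    from that obtain u v where uv: "u \<in> C" "v \<in> C" "f mod ?M = code_poly u" "h mod ?M = code_poly v"
      by (auto simp: J_def)
    hence "(f + h) mod ?M = code_poly (u + v)"
      using lin(1) by (simp add: poly_mod_add_left code_poly_add[of _ n] subset_iff)
    with uv lin(3) show ?thesis
      by (auto simp: J_def)
  qed
  have smult: "Polynomial.smult c f \<in> J" if "f \<in> J" for c f
  proof -
    from that obtain v where v: "v \<in> C" "f mod ?M = code_poly v"
      by (auto simp: J_def)
    hence "Polynomial.smult c f mod ?M = code_poly (c \<cdot>\<^sub>v v)"
      by (simp add: mod_smult_left code_poly_smult)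
    with v lin(4) show ?thesis
      by (auto simp: J_def)
  qed
  have times_x: "pCons 0 f \<in> J" if "f \<in> J" for f
  proof -
    from that obtain v where v: "v \<in> C" "f mod ?M = code_poly v"
      by (auto simp: J_def)
    have "pCons 0 f mod ?M = ([:0, 1:] * f) mod ?M"
      by simp
    also have "\<dots> = ([:0, 1:] * code_poly v) mod ?M"
      by (metis v(2) mod_mult_right_eq)
    also have "[:0, 1:] * code_poly v = pCons 0 (code_poly v)"
      by simp
    also have "\<dots> = code_poly (cyclic_shift n v) + [:v $ (n - 1):] * ?M"
      using code_poly_cyclic_shift[OF _ n, of v] v lin(1) by auto
    also have "\<dots> mod ?M = code_poly (cyclic_shift n v) mod ?M"
      by (rule mod_mult_self1)
    also have "\<dots> = code_poly (cyclic_shift n v)"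
      using mod_code shift[OF v(1)] lin(1) by auto
    finally show ?thesis
      using shift[OF v(1)] by (auto simp: J_def)
  qed
  have zero: "0 \<in> J"
    using lin(2) by (auto simp: J_def intro!: image_eqI[of _ _ "0\<^sub>v n"])
  \<comment> \<open>Scalars and x generate all polynomials, so induction on the coefficients of
    \<open>h\<close> suffices.\<close>
  have mult: "h * f \<in> J" if "f \<in> J" for f h
  proof (induction h)
    case 0
    thus ?case by (simp add: zero)
  next
    case (pCons a h)
    have "pCons a h * f = Polynomial.smult a f + pCons 0 (h * f)"
      by (simp add: mult_pCons_left)
    thus ?case
      using add smult times_x that pCons.IH by simp
  qed
  \<comment> \<open>x^n - 1 reduces to the zero codeword. This makes \<open>J\<close> nonzero even
    for the zero code and yields that \<open>g\<close> divides x^n - 1.\<close>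
  have M: "?M \<in> J"
    using lin(2) by (auto simp: J_def intro!: image_eqI[of _ _ "0\<^sub>v n"])
  obtain g where g: "Polynomial.lead_coeff g = 1" "\<And>f. f \<in> J \<longleftrightarrow> g dvd f"
    using poly_ideal_principal[of J, OF add mult M monom_minus_1_neq_0[OF n]] by blast
  show ?thesis
  proof
    show "C = {v \<in> carrier_vec n. g dvd code_poly v}"
    proof (intro equalityI subsetI)
      fix v assume "v \<in> C"
      thus "v \<in> {v \<in> carrier_vec n. g dvd code_poly v}"
        using lin(1) mod_code[of v] by (auto simp: J_def simp flip: g(2))
    next
      fix v assume v: "v \<in> {v \<in> carrier_vec n. g dvd code_poly v}"
      hence "code_poly v \<in> code_poly ` C"
        using mod_code[of v] by (auto simp: J_def simp flip: g(2))
      thus "v \<in> C"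
        using v lin(1) inj_on_code_poly[of n] by (auto dest!: inj_onD)
    qed
  qed (use g M in auto)
qed

section \<open>Counting codewords\<close>

lemma card_carrier_vec: "card (carrier_vec n :: 'a::finite vec set) = CARD('a) ^ n"
proof -
  have "bij_betw list_of_vec (carrier_vec n) {xs :: 'a list. set xs \<subseteq> UNIV \<and> length xs = n}"
  proof (rule bij_betwI[of _ _ _ vec_of_list])
    show "list_of_vec \<in> carrier_vec n \<rightarrow> {xs :: 'a list. set xs \<subseteq> UNIV \<and> length xs = n}"
      by auto
    show "vec_of_list \<in> {xs :: 'a list. set xs \<subseteq> UNIV \<and> length xs = n} \<rightarrow> carrier_vec n"
      by (auto intro: carrier_vecI)
  qed (simp_all only: list_vec vec_list)
  hence "card (carrier_vec n :: 'a vec set) =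
      card {xs :: 'a list. set xs \<subseteq> UNIV \<and> length xs = n}"
    by (rule bij_betw_same_card)
  also have "\<dots> = CARD('a) ^ n"
    by (rule card_lists_length_eq) simp
  finally show ?thesis .
qed

lemma finite_carrier_vec: "finite (carrier_vec n :: 'a::finite vec set)"
  by (rule card_ge_0_finite) (simp add: card_carrier_vec)

text \<open>Multiplication by \<open>g\<close> encodes messages of length n - deg g bijectively as
  codewords; division by \<open>g\<close> decodes them.\<close>

lemma card_code_of_generator:
  fixes g :: "'a::{field,finite} poly"
  assumes n: "n > 0" and g: "g \<noteq> 0" "Polynomial.degree g \<le> n"
  shows "card {v \<in> carrier_vec n. g dvd code_poly v} = CARD('a) ^ (n - Polynomial.degree g)"
proof -
  let ?m = "n - Polynomial.degree g"
  \<comment> \<open>The zero message is treated apart: if \<open>g\<close> has degree n, the message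
    length is 0 and \<open>degree_code_poly\<close> does not apply.\<close>
  have deg: "Polynomial.degree (g * code_poly w) < n" if "w \<in> carrier_vec ?m" for w
  proof (cases "w = 0\<^sub>v ?m")
    case False
    hence "?m > 0" using that by (intro Nat.gr0I) auto
    with degree_code_poly[OF that] degree_mult_le[of g "code_poly w"] show ?thesis
      by linarith
  qed (use n in simp)
  have "bij_betw (\<lambda>w. vec n (Polynomial.coeff (g * code_poly w))) (carrier_vec ?m)
     {v \<in> carrier_vec n. g dvd code_poly v}"
  proof (rule bij_betwI[of _ _ _ "\<lambda>v. vec ?m (Polynomial.coeff (code_poly v div g))"])
    show "(\<lambda>w. vec n (Polynomial.coeff (g * code_poly w)))
        \<in> carrier_vec ?m \<rightarrow> {v \<in> carrier_vec n. g dvd code_poly v}"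
      using deg by (auto simp: code_poly_vec_coeff)
    show "(\<lambda>v. vec ?m (Polynomial.coeff (code_poly v div g)))
        \<in> {v \<in> carrier_vec n. g dvd code_poly v} \<rightarrow> carrier_vec ?m"
      by auto
    show "vec ?m (Polynomial.coeff (code_poly (vec n (Polynomial.coeff (g * code_poly w))) div g)) = w"
      if "w \<in> carrier_vec ?m" for w
      using deg[OF that] g that by (simp add: code_poly_vec_coeff vec_coeff_code_poly)
    show "vec n (Polynomial.coeff (g * code_poly
        (vec ?m (Polynomial.coeff (code_poly v div g))))) = v"
      if v: "v \<in> {v \<in> carrier_vec n. g dvd code_poly v}" for v
    proof -
      from v have "g dvd code_poly v"
        by simp
      then obtain h where h: "code_poly v = g * h"
        by (rule dvdE)
      have "code_poly (vec ?m (Polynomial.coeff h)) = h"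
      proof (cases "h = 0")
        case False
        with g h v n degree_code_poly[of v n] show ?thesis
          by (intro code_poly_vec_coeff) (auto simp: degree_mult_eq)
      qed (auto simp: poly_eq_iff coeff_code_poly)
      hence "g * code_poly (vec ?m (Polynomial.coeff (code_poly v div g))) = code_poly v"
        using g(1) by (simp add: h)
      with v show ?thesis
        by (simp only: vec_coeff_code_poly mem_Collect_eq)
    qed
  qed
  hence "card (carrier_vec ?m :: 'a vec set) = card {v \<in> carrier_vec n. g dvd code_poly v}"
    by (rule bij_betw_same_card)
  thus ?thesis
    by (simp add: card_carrier_vec)
qed

text \<open>Coordinates in a finite basis identify the code with the functions from that basis to
  the field. This lets cardinalities replace dimensions from here on.\<close>

lemma card_linear_code:
  fixes C :: "'a::finite_field vec set"
  assumes "linear_code n C"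
  shows "card C = CARD('a) ^ code_dim n C"
proof -
  let ?K = "class_ring :: 'a ring"
  let ?V = "(module_vec TYPE('a) n)\<lparr>carrier := C\<rparr>"
  interpret V: vectorspace ?K ?V
    using vectorspace.subspace_is_vs[OF vec_vs] assms
    by (simp add: linear_code_def module_vec_simps)
  have fin: "finite C"
    using assms finite_carrier_vec finite_subset by (auto simp: linear_code_iff)
  have "V.gen_set C"
    using V.in_own_span[of C] V.span_is_subset2[of C] by auto
  hence "V.fin_dim"
    unfolding V.fin_dim_def using fin by auto
  then obtain B where B: "finite B" "V.basis B"
    using V.finite_basis_exists by blast
  hence BC: "B \<subseteq> C" and dim: "code_dim n C = card B"
    using V.dim_basis by (auto simp: V.basis_def code_dim_def)
  have "\<forall>v\<in>C. \<exists>!a. a \<in> B \<rightarrow>\<^sub>E UNIV \<and> V.lincomb a B = v"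
    using V.basis_criterion[of B] B BC by auto
  moreover have "V.lincomb a B \<in> C" for a
    using V.lincomb_closed[of B a] BC by auto
  ultimately have "bij_betw (\<lambda>a. V.lincomb a B) (B \<rightarrow>\<^sub>E UNIV) C"
    unfolding bij_betw_def inj_on_def by (auto simp: image_iff)
  hence "card C = card (B \<rightarrow>\<^sub>E (UNIV :: 'a set))"
    by (metis bij_betw_same_card)
  thus ?thesis
    using B by (simp add: card_PiE dim)
qed

section \<open>Unions of cyclotomic cosets\<close>

text \<open>A union of cosets is encoded by stability under a single multiplication by q, which
  matches a single application of Frobenius.\<close>

definition coset_closed :: "nat \<Rightarrow> nat \<Rightarrow> nat set \<Rightarrow> bool" where
  "coset_closed q n S \<longleftrightarrow> S \<subseteq> {..<n} \<and> (\<forall>t\<in>S. t * q mod n \<in> S)"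

lemma inj_on_mult_mod:
  fixes n q :: nat
  assumes "coprime n q"
  shows "inj_on (\<lambda>t. t * q mod n) {..<n}"
proof (rule inj_onI)
  fix s t assume st: "s \<in> {..<n}" "t \<in> {..<n}" "s * q mod n = t * q mod n"
  hence "[s * q = t * q] (mod n)"
    by (simp add: cong_def)
  hence "[s = t] (mod n)"
    using assms cong_mult_rcancel_nat by (metis coprime_commute)
  thus "s = t"
    using st by (simp add: cong_def)
qed

lemma coset_closed_image:
  assumes "coprime n q" "coset_closed q n S"
  shows "(\<lambda>t. t * q mod n) ` S = S"
proof (rule card_subset_eq)
  have S: "S \<subseteq> {..<n}"
    using assms by (simp add: coset_closed_def)
  thus "finite S"
    by (rule finite_subset) simp
  show "card ((\<lambda>t. t * q mod n) ` S) = card S"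
    using S inj_on_mult_mod[OF assms(1)] by (intro card_image) (rule inj_on_subset)
qed (use assms in \<open>auto simp: coset_closed_def\<close>)

text \<open>Multiplication by q is injective on residues and maps \<open>S\<close> onto itself, so
  nothing outside \<open>S\<close> can enter it. Hence differences of coset-closed sets are
  coset-closed.\<close>

lemma coset_closed_iff:
  assumes "coprime n q" "coset_closed q n S" "t < n"
  shows "t * q mod n \<in> S \<longleftrightarrow> t \<in> S"
proof
  assume "t * q mod n \<in> S"
  hence "t * q mod n \<in> (\<lambda>s. s * q mod n) ` S"
    unfolding coset_closed_image[OF assms(1,2)] .
  thus "t \<in> S"
    using inj_on_image_mem_iff[OF inj_on_mult_mod[OF assms(1)], of t S] assms by (simp add: coset_closed_def)
qed (use assms in \<open>auto simp: coset_closed_def\<close>)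

lemma coset_closed_Diff:
  assumes "coprime n q" "coset_closed q n S" "coset_closed q n T"
  shows "coset_closed q n (S - T)"
  using assms(2) coset_closed_iff[OF assms(1,3)] by (auto simp: coset_closed_def)

lemma coset_closed_Un: "coset_closed q n S \<Longrightarrow> coset_closed q n T \<Longrightarrow> coset_closed q n (S \<union> T)"
  by (auto simp: coset_closed_def)

text \<open>Negation commutes with multiplication by q, as seen after adding tq to both sides. The
  outer reduction matters for the residue 0, whose negative would otherwise be written n.\<close>

lemma complement_mult_mod:
  fixes n t q :: nat
  assumes "n > 0" "t < n"
  shows "(n - t * q mod n) mod n = ((n - t) mod n) * q mod n"
proof -
  have "[(n - t) mod n * q + t * q mod n = (n - t) * q + t * q] (mod n)"
    by (intro cong_add) (simp_all add: cong_def mod_mult_left_eq)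
  also have "(n - t) * q + t * q = n * q"
    using assms by (simp flip: add_mult_distrib)
  also have "[n * q = n - t * q mod n + t * q mod n] (mod n)"
    using assms by (simp add: cong_def)
  finally have "[(n - t) mod n * q = n - t * q mod n] (mod n)"
    by (simp only: cong_add_rcancel_nat)
  thus ?thesis
    by (simp add: cong_def)
qed

lemma coset_closed_negative:
  assumes "n > 0" "coset_closed q n S"
  shows "coset_closed q n {t. t < n \<and> (n - t) mod n \<in> S}"
  using assms by (auto simp: coset_closed_def complement_mult_mod)

text \<open>Negation modulo n is an involution, so the image of \<open>T\<close> is also its
  preimage, which is easier to reason with.\<close>

lemma set_multiple_minus_1:
  assumes "n > 0" "T \<subseteq> {..<n}"
  shows "set_multiple n (- 1) T = {t. t < n \<and> (n - t) mod n \<in> T}"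
proof -
  have neg: "nat (((- 1) * int t) mod int n) = (n - t) mod n" if "t < n" for t
  proof -
    have "((- 1) * int t) mod int n = (int n - int t) mod int n"
      by simp
    also have "\<dots> = int ((n - t) mod n)"
      using that by (simp add: of_nat_diff zmod_int)
    finally show ?thesis
      by simp
  qed
  have invol: "(n - (n - t) mod n) mod n = t" if "t < n" for t
    using that by (cases "t = 0") auto
  show ?thesis
  proof (intro equalityI subsetI)
    fix s assume "s \<in> set_multiple n (- 1) T"
    then obtain t where "t \<in> T" "s = (n - t) mod n"
      using neg assms(2) by (force simp: set_multiple_def)
    thus "s \<in> {t. t < n \<and> (n - t) mod n \<in> T}"
      using invol[of t] assms by auto
  next
    fix s assume s: "s \<in> {t. t < n \<and> (n - t) mod n \<in> T}"
    hence "s = nat (((- 1) * int ((n - s) mod n)) mod int n)"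
      using neg[of "(n - s) mod n"] invol[of s] assms(1) by simp
    thus "s \<in> set_multiple n (- 1) T"
      using s unfolding set_multiple_def by blast
  qed
qed

lemma union_of_cosets_coset_closed:
  assumes "n > 0" "union_of_cosets q n T"
  shows "coset_closed q n T"
proof -
  obtain S where S: "T = (\<Union>x\<in>S. cyclotomic_coset q n x)"
    using assms(2) by (auto simp: union_of_cosets_def)
  have "t * q mod n \<in> cyclotomic_coset q n x" if t: "t \<in> cyclotomic_coset q n x" for t x
  proof -
    obtain i where "t = x * q ^ i mod n"
      using t by (auto simp: cyclotomic_coset_def)
    hence "t * q mod n = x * q ^ Suc i mod n"
      by (simp add: mod_mult_right_eq mult_ac)
    thus ?thesis
      unfolding cyclotomic_coset_def by blast
  qed
  moreover have "cyclotomic_coset q n x \<subseteq> {..<n}" for x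
    using assms(1) by (auto simp: cyclotomic_coset_def)
  ultimately show ?thesis
    unfolding coset_closed_def S by blast
qed

lemma sum_add_mod:
  fixes f :: "nat \<Rightarrow> 'b::comm_monoid_add"
  assumes "n > 0"
  shows "(\<Sum>i<n. f ((i + l) mod n)) = (\<Sum>i<n. f i)"
proof -
  have "inj_on (\<lambda>i. (i + l) mod n) {..<n}"
  proof (rule inj_onI)
    fix i j assume ij: "i \<in> {..<n}" "j \<in> {..<n}" "(i + l) mod n = (j + l) mod n"
    hence "[i = j] (mod n)"
      by (metis cong_add_rcancel_nat cong_def)
    thus "i = j"
      using ij by (simp add: cong_def)
  qed
  moreover from this have "(\<lambda>i. (i + l) mod n) ` {..<n} = {..<n}"
    using assms by (intro card_subset_eq) (auto simp: card_image)
  ultimately show ?thesis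
    using sum.reindex[of "\<lambda>i. (i + l) mod n" "{..<n}" f] by simp
qed

section \<open>Spectra and defining sets\<close>

text \<open>The discrete Fourier transform of \<open>v\<close> at frequency \<open>t\<close>, with
  values in the closure because \<open>\<alpha>\<close> lives there.\<close>

definition spectrum_at :: "'a::field alg_closure \<Rightarrow> 'a vec \<Rightarrow> nat \<Rightarrow> 'a alg_closure" where
  "spectrum_at \<alpha> v t = poly (map_poly to_ac (code_poly v)) (\<alpha> ^ t)"

definition zeros_code :: "nat \<Rightarrow> 'a::field alg_closure \<Rightarrow> nat set \<Rightarrow> 'a vec set" where
  "zeros_code n \<alpha> S = {v \<in> carrier_vec n. \<forall>t\<in>S. spectrum_at \<alpha> v t = 0}"

definition linear_factors :: "'a::field \<Rightarrow> nat set \<Rightarrow> 'a poly" where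
  "linear_factors \<alpha> S = (\<Prod>t\<in>S. [:- (\<alpha> ^ t), 1:])"

lemma linear_factors_monic: "Polynomial.lead_coeff (linear_factors \<alpha> S) = 1"
  unfolding linear_factors_def lead_coeff_prod by simp

lemma degree_linear_factors: "Polynomial.degree (linear_factors \<alpha> S) = card S"
  unfolding linear_factors_def by (subst degree_prod_eq_sum_degree) auto

lemma poly_linear_factors_eq_0_iff:
  "finite S \<Longrightarrow> poly (linear_factors \<alpha> S) x = 0 \<longleftrightarrow> (\<exists>t\<in>S. x = \<alpha> ^ t)"
  by (simp add: linear_factors_def poly_prod prod_zero_iff)

text \<open>Distinct roots can be split off one at a time.\<close>

lemma linear_factors_dvd_iff:
  assumes "finite S" "inj_on (\<lambda>t. \<alpha> ^ t) S"
  shows "linear_factors \<alpha> S dvd f \<longleftrightarrow> (\<forall>t\<in>S. poly f (\<alpha> ^ t) = 0)"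
  using assms
proof (induction S arbitrary: f rule: finite_induct)
  case (insert s S)
  have split: "linear_factors \<alpha> (insert s S) = [:- (\<alpha> ^ s), 1:] * linear_factors \<alpha> S"
    using insert.hyps by (simp add: linear_factors_def)
  have IH: "linear_factors \<alpha> S dvd f \<longleftrightarrow> (\<forall>t\<in>S. poly f (\<alpha> ^ t) = 0)" for f
    using insert by simp
  show ?case
  proof
    assume "linear_factors \<alpha> (insert s S) dvd f"
    hence "[:- (\<alpha> ^ s), 1:] dvd f" "linear_factors \<alpha> S dvd f"
      unfolding split by (metis dvd_mult_left, metis dvd_mult_right)
    thus "\<forall>t\<in>insert s S. poly f (\<alpha> ^ t) = 0"
      using IH by (auto simp: poly_eq_0_iff_dvd)
  next
    assume roots: "\<forall>t\<in>insert s S. poly f (\<alpha> ^ t) = 0"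
    then obtain h where h: "f = [:- (\<alpha> ^ s), 1:] * h"
      by (auto simp: poly_eq_0_iff_dvd elim: dvdE)
    \<comment> \<open>The factor removed does not vanish at the other powers, so these must be roots
      of the cofactor.\<close>
    have "poly h (\<alpha> ^ t) = 0" if "t \<in> S" for t
      using that roots insert.prems insert.hyps(2) unfolding h by (auto simp: inj_on_def)
    hence "linear_factors \<alpha> S dvd h"
      using IH by blast
    thus "linear_factors \<alpha> (insert s S) dvd f"
      unfolding split h by (rule mult_dvd_mono[OF dvd_refl])
  qed
qed (simp add: linear_factors_def)

text \<open>The cofactor must vanish at every root that \<open>g\<close> misses. Counting degrees
  then leaves \<open>g\<close> no factors beyond those of its own roots in the list.\<close>

lemma monic_dvd_linear_factors:
  assumes S: "finite S" "inj_on (\<lambda>t. \<alpha> ^ t) S"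
    and g: "Polynomial.lead_coeff g = 1" "g dvd linear_factors \<alpha> S"
  shows "g = linear_factors \<alpha> {t \<in> S. poly g (\<alpha> ^ t) = 0}"
proof -
  let ?R = "{t \<in> S. poly g (\<alpha> ^ t) = 0}"
  obtain h where h: "linear_factors \<alpha> S = g * h"
    using g(2) by (rule dvdE)
  have nz: "g \<noteq> 0" "h \<noteq> 0"
    using g(1) h linear_factors_monic[of \<alpha> S] by auto
  have dvd_g: "linear_factors \<alpha> ?R dvd g"
    using S by (subst linear_factors_dvd_iff) (auto intro: inj_on_subset)
  have "poly g (\<alpha> ^ t) * poly h (\<alpha> ^ t) = 0" if "t \<in> S" for t
    using poly_linear_factors_eq_0_iff[OF S(1), of \<alpha> "\<alpha> ^ t"] that unfolding h by auto
  hence "linear_factors \<alpha> (S - ?R) dvd h"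
    using S by (subst linear_factors_dvd_iff) (auto intro: inj_on_subset)
  hence "card (S - ?R) \<le> Polynomial.degree h"
    using nz dvd_imp_degree_le by (metis degree_linear_factors)
  moreover have "card S = Polynomial.degree g + Polynomial.degree h"
    using nz h by (metis degree_linear_factors degree_mult_eq)
  moreover have "card S = card ?R + card (S - ?R)"
    using S(1) card_mono[of S ?R] by (subst card_Diff_subset) auto
  ultimately have "Polynomial.degree g \<le> Polynomial.degree (linear_factors \<alpha> ?R)"
    by (simp add: degree_linear_factors)
  thus ?thesis
    using monic_dvd_degree_eq[OF dvd_g] g(1) linear_factors_monic by metis
qed

section \<open>Cyclic codes relative to a fixed primitive root of unity\<close>

context
  fixes n :: nat and \<alpha> :: "'a::finite_field alg_closure"
  assumes n: "n > 0"
    and coprime: "coprime n CARD('a)"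
    and prim: "primitive_root_of_unity n \<alpha>"
begin

lemma root_power_n: "\<alpha> ^ n = 1"
  using prim by (simp add: primitive_root_of_unity_def)

lemma root_nonzero: "\<alpha> \<noteq> 0"
  using root_power_n n by (auto simp: power_0_left)

lemma root_power_mod: "\<alpha> ^ (k mod n) = \<alpha> ^ k"
proof -
  have "\<alpha> ^ k = \<alpha> ^ (n * (k div n) + k mod n)"
    by simp
  also have "\<dots> = \<alpha> ^ (k mod n)"
    unfolding power_add power_mult root_power_n by simp
  finally show ?thesis ..
qed

lemma inj_on_root_power: "inj_on (\<lambda>t. \<alpha> ^ t) {..<n}"
proof -
  have False if "s < t" "t < n" "\<alpha> ^ s = \<alpha> ^ t" for s t
  proof -
    have "\<alpha> ^ t = \<alpha> ^ s * \<alpha> ^ (t - s)"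
      using that(1) by (simp flip: power_add)
    hence "\<alpha> ^ (t - s) = 1"
      using that(3) root_nonzero by simp
    moreover have "0 < t - s" "t - s < n"
      using that by auto
    ultimately show False
      using prim by (auto simp: primitive_root_of_unity_def)
  qed
  thus ?thesis
    unfolding inj_on_def by (metis lessThan_iff linorder_neqE_nat)
qed

text \<open>The first n powers of \<open>\<alpha>\<close> are n distinct roots of a monic polynomial
  of degree n.\<close>

lemma linear_factors_lessThan: "linear_factors \<alpha> {..<n} = Polynomial.monom 1 n - 1"
proof (rule monic_dvd_degree_eq)
  have "(\<alpha> ^ t) ^ n = 1" for t
    by (simp add: mult.commute flip: power_mult) (simp add: power_mult root_power_n)
  thus "linear_factors \<alpha> {..<n} dvd Polynomial.monom 1 n - 1"
    by (subst linear_factors_dvd_iff) (auto simp: inj_on_root_power poly_monom)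
  show "Polynomial.degree (Polynomial.monom 1 n - 1 :: 'a alg_closure poly)
      \<le> Polynomial.degree (linear_factors \<alpha> {..<n})"
    by (simp add: n degree_linear_factors degree_monom_minus_1)
qed (rule linear_factors_monic lead_coeff_monom_minus_1[OF n])+

lemma spectrum_at_eq_sum:
  assumes "v \<in> carrier_vec n"
  shows "spectrum_at \<alpha> v t = (\<Sum>i<n. to_ac (v $ i) * \<alpha> ^ (t * i))"
proof -
  have "map_poly to_ac (code_poly v) = (\<Sum>i<n. Polynomial.monom (to_ac (v $ i)) i)"
    using assms by (auto simp: poly_eq_iff coeff_map_poly coeff_code_poly coeff_sum)
  thus ?thesis
    by (simp add: spectrum_at_def poly_sum poly_monom power_mult)
qed

lemma spectrum_at_mod: "spectrum_at \<alpha> v (t mod n) = spectrum_at \<alpha> v t"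
  by (simp add: spectrum_at_def root_power_mod)

text \<open>The coordinates of \<open>v\<close> are fixed by Frobenius, so evaluation at z^q is the
  q-th power of evaluation at z.\<close>

lemma spectrum_at_frobenius: "spectrum_at \<alpha> v (t * CARD('a)) = spectrum_at \<alpha> v t ^ CARD('a)"
proof -
  let ?f = "map_poly to_ac (code_poly v)"
  have "map_poly (\<lambda>x. x ^ CARD('a)) ?f = ?f"
    by (rule poly_eqI)
      (simp add: coeff_map_poly finite_field_power_card_eq_same flip: to_ac_power)
  thus ?thesis
    using frobenius_hom.poly_map_poly[of ?f "\<alpha> ^ t"]
    by (simp add: spectrum_at_def power_mult)
qed

lemma spectrum_at_cyclic_shift:
  assumes "v \<in> carrier_vec n"
  shows "spectrum_at \<alpha> (cyclic_shift n v) t = \<alpha> ^ t * spectrum_at \<alpha> v t"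
proof -
  have "(\<alpha> ^ t) ^ n = 1"
    by (simp add: mult.commute flip: power_mult) (simp add: power_mult root_power_n)
  hence "poly (map_poly to_ac (pCons 0 (code_poly v))) (\<alpha> ^ t) =
      spectrum_at \<alpha> (cyclic_shift n v) t"
    unfolding code_poly_cyclic_shift[OF assms n]
    by (simp add: spectrum_at_def to_ac_hom.map_poly_hom_smult hom_distribs poly_monom)
  thus ?thesis
    by (simp add: spectrum_at_def to_ac_hom.map_poly_pCons_hom)
qed

text \<open>Resolves the definite description: by injectivity of the powers of
  \<open>\<alpha>\<close>, the roots of a product recover its index set.\<close>

lemma defining_set_eqI:
  assumes S: "S \<subseteq> {..<n}" and g: "generator_poly n C = g" "map_poly to_ac g = linear_factors \<alpha> S"
  shows "defining_set n \<alpha> C = S"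
  unfolding defining_set_def linear_factors_def[symmetric] g
proof (rule the_equality)
  fix T assume T: "T \<subseteq> {..<n} \<and> linear_factors \<alpha> S = linear_factors \<alpha> T"
  have "R = {t. t < n \<and> poly (linear_factors \<alpha> R) (\<alpha> ^ t) = 0}" if "R \<subseteq> {..<n}" for R
    using that inj_on_root_power finite_subset[OF that]
    by (auto simp: poly_linear_factors_eq_0_iff inj_on_def)
  from this[of S] this[of T] show "T = S"
    using S T by simp
qed (use S in simp)

lemma generator_linear_factors:
  assumes g: "Polynomial.lead_coeff g = 1" "g dvd Polynomial.monom 1 n - 1"
  obtains S where "S \<subseteq> {..<n}" "map_poly to_ac g = linear_factors \<alpha> S"
proof -
  have "map_poly to_ac g dvd map_poly to_ac (Polynomial.monom 1 n - 1)"
    using g(2) by (rule to_ac_poly.hom_dvd)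
  also have "map_poly to_ac (Polynomial.monom 1 n - 1) = linear_factors \<alpha> {..<n}"
    by (simp add: linear_factors_lessThan hom_distribs)
  finally have "map_poly to_ac g dvd linear_factors \<alpha> {..<n}" .
  moreover have "Polynomial.lead_coeff (map_poly to_ac g) = 1"
    using g(1) by (simp add: to_ac_hom.hom_lead_coeff)
  ultimately have "map_poly to_ac g =
      linear_factors \<alpha> {t \<in> {..<n}. poly (map_poly to_ac g) (\<alpha> ^ t) = 0}"
    using inj_on_root_power by (intro monic_dvd_linear_factors) auto
  thus ?thesis
    by (rule that[rotated]) auto
qed

text \<open>Divisibility does not change under field extension, so it may be tested over the
  closure, where \<open>g\<close> splits into distinct linear factors.\<close>

lemma dvd_code_poly_iff_spectrum:
  assumes "S \<subseteq> {..<n}" "map_poly to_ac g = linear_factors \<alpha> S"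
  shows "g dvd code_poly v \<longleftrightarrow> (\<forall>t\<in>S. spectrum_at \<alpha> v t = 0)"
proof -
  have "g dvd code_poly v \<longleftrightarrow> linear_factors \<alpha> S dvd map_poly to_ac (code_poly v)"
    using to_ac_hom.dvd_map_poly_hom_imp_dvd to_ac_poly.hom_dvd unfolding assms(2)[symmetric] by blast
  also have "\<dots> \<longleftrightarrow> (\<forall>t\<in>S. spectrum_at \<alpha> v t = 0)"
    unfolding spectrum_at_def
    using assms(1) inj_on_root_power by (intro linear_factors_dvd_iff) (auto intro: inj_on_subset finite_subset)
  finally show ?thesis .
qed

lemma cyclic_code_defining_set:
  assumes "cyclic_code n C"
  obtains g where "C = {v \<in> carrier_vec n. g dvd code_poly v}" "defining_set n \<alpha> C \<subseteq> {..<n}"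
    "map_poly to_ac g = linear_factors \<alpha> (defining_set n \<alpha> C)"
proof -
  obtain g where g: "Polynomial.lead_coeff g = 1" "g dvd Polynomial.monom 1 n - 1"
      "C = {v \<in> carrier_vec n. g dvd code_poly v}"
    using cyclic_code_generator[OF n assms] .
  obtain S where S: "S \<subseteq> {..<n}" "map_poly to_ac g = linear_factors \<alpha> S"
    using generator_linear_factors[OF g(1,2)] .
  have "defining_set n \<alpha> C = S"
    using generator_poly_eqI[OF n g] S by (intro defining_set_eqI)
  with g(3) S that show ?thesis
    by blast
qed

lemma cyclic_code_eq_zeros_code:
  assumes "cyclic_code n C"
  shows "C = zeros_code n \<alpha> (defining_set n \<alpha> C)"
proof -
  obtain g where g: "C = {v \<in> carrier_vec n. g dvd code_poly v}" "defining_set n \<alpha> C \<subseteq> {..<n}"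
      "map_poly to_ac g = linear_factors \<alpha> (defining_set n \<alpha> C)"
    using cyclic_code_defining_set[OF assms] .
  show ?thesis
    using g(1) dvd_code_poly_iff_spectrum[OF g(2,3)] by (auto simp: zeros_code_def)
qed

text \<open>The generator has coefficients in the base field, so the q-th power of a root is again a
  root.\<close>

lemma coset_closed_defining_set:
  assumes "cyclic_code n C"
  shows "coset_closed CARD('a) n (defining_set n \<alpha> C)"
proof -
  let ?S = "defining_set n \<alpha> C"
  obtain g where S: "?S \<subseteq> {..<n}" and g: "map_poly to_ac g = linear_factors \<alpha> ?S"
    using cyclic_code_defining_set[OF assms] .
  have root_iff: "poly (map_poly to_ac g) (\<alpha> ^ t) = 0 \<longleftrightarrow> t \<in> ?S" if "t < n" for t
    using that S inj_on_root_power finite_subset[OF S]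
    by (auto simp: g poly_linear_factors_eq_0_iff inj_on_def)
  have "map_poly (\<lambda>x. x ^ CARD('a)) (map_poly to_ac g) = map_poly to_ac g"
    by (rule poly_eqI)
      (simp add: coeff_map_poly finite_field_power_card_eq_same flip: to_ac_power)
  hence frob: "poly (map_poly to_ac g) (\<alpha> ^ (t * CARD('a) mod n)) =
      poly (map_poly to_ac g) (\<alpha> ^ t) ^ CARD('a)" for t
    using frobenius_hom.poly_map_poly[of "map_poly to_ac g" "\<alpha> ^ t"]
    by (simp add: root_power_mod power_mult)
  have "t * CARD('a) mod n \<in> ?S" if "t \<in> ?S" for t
  proof (subst root_iff[symmetric])
    have "poly (map_poly to_ac g) (\<alpha> ^ t) = 0"
      using that S root_iff by blast
    thus "poly (map_poly to_ac g) (\<alpha> ^ (t * CARD('a) mod n)) = 0"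
      by (simp add: frob)
  qed (simp add: n)
  with S show ?thesis
    by (simp add: coset_closed_def)
qed

text \<open>Frobenius permutes the linear factors indexed by a coset-closed set. Their product is
  therefore fixed and descends to the base field.\<close>

lemma coset_closed_generator:
  assumes "coset_closed CARD('a) n S"
  obtains g :: "'a poly" where "Polynomial.lead_coeff g = 1" "g dvd Polynomial.monom 1 n - 1"
    "map_poly to_ac g = linear_factors \<alpha> S"
proof -
  let ?F = "\<lambda>x :: 'a alg_closure. x ^ CARD('a)"
  have S: "S \<subseteq> {..<n}"
    using assms by (simp add: coset_closed_def)
  have "map_poly ?F (linear_factors \<alpha> S) = (\<Prod>t\<in>S. [:- (\<alpha> ^ (t * CARD('a) mod n)), 1:])"
    unfolding linear_factors_def frobenius_poly.hom_prod
    by (intro prod.cong refl) (simp add: frobenius_hom.map_poly_pCons_hom frobenius_hom.hom_uminus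
        root_power_mod flip: power_mult)
  also have "\<dots> = linear_factors \<alpha> ((\<lambda>t. t * CARD('a) mod n) ` S)"
    unfolding linear_factors_def using inj_on_subset[OF inj_on_mult_mod[OF coprime] S]
    by (subst prod.reindex) simp_all
  also have "\<dots> = linear_factors \<alpha> S"
    using coset_closed_image[OF coprime assms] by simp
  finally obtain g where g: "map_poly to_ac g = linear_factors \<alpha> S"
    by (rule frobenius_fixed_poly_descends)
  show ?thesis
  proof (rule that)
    have "to_ac (Polynomial.lead_coeff g) = 1"
      using linear_factors_monic[of \<alpha> S] unfolding g[symmetric] to_ac_hom.hom_lead_coeff .
    thus "Polynomial.lead_coeff g = 1"
      by simp
    have "linear_factors \<alpha> S dvd linear_factors \<alpha> {..<n}"
      unfolding linear_factors_def using S by (intro prod_dvd_prod_subset) auto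
    hence "map_poly to_ac g dvd map_poly to_ac (Polynomial.monom 1 n - 1)"
      by (simp add: g linear_factors_lessThan hom_distribs)
    thus "g dvd Polynomial.monom 1 n - 1"
      by (rule to_ac_hom.dvd_map_poly_hom_imp_dvd)
  qed (rule g)
qed

lemma
  assumes "coset_closed CARD('a) n S"
  shows cyclic_zeros_code: "cyclic_code n (zeros_code n \<alpha> S)"
    and defining_set_zeros_code: "defining_set n \<alpha> (zeros_code n \<alpha> S) = S"
    and card_zeros_code: "card (zeros_code n \<alpha> S) = CARD('a) ^ (n - card S)"
proof -
  obtain g :: "'a poly" where g: "Polynomial.lead_coeff g = 1" "g dvd Polynomial.monom 1 n - 1"
    "map_poly to_ac g = linear_factors \<alpha> S"
    using coset_closed_generator[OF assms] .
  have S: "S \<subseteq> {..<n}"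
    using assms by (simp add: coset_closed_def)
  have Z: "zeros_code n \<alpha> S = {v \<in> carrier_vec n. g dvd code_poly v}"
    using dvd_code_poly_iff_spectrum[OF S g(3)] by (auto simp: zeros_code_def)
  show "defining_set n \<alpha> (zeros_code n \<alpha> S) = S"
    using generator_poly_eqI[OF n g(1,2) Z] g(3) S by (intro defining_set_eqI)
  have deg: "Polynomial.degree g = card S"
    using arg_cong[OF g(3), of Polynomial.degree] by (simp add: degree_linear_factors)
  have "card S \<le> n"
    using card_mono[OF _ S] by simp
  moreover have "g \<noteq> 0"
    using g(1) by auto
  ultimately show "card (zeros_code n \<alpha> S) = CARD('a) ^ (n - card S)"
    unfolding Z using card_code_of_generator[OF n, of g] deg by simp
  have "linear_code n (zeros_code n \<alpha> S)"
    unfolding Z linear_code_iff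
    by (auto simp: code_poly_add[of _ n] code_poly_smult dvd_smult)
  moreover have "cyclic_shift n v \<in> zeros_code n \<alpha> S" if "v \<in> zeros_code n \<alpha> S" for v
    using that spectrum_at_cyclic_shift[of v] by (auto simp: zeros_code_def cyclic_shift_def)
  ultimately show "cyclic_code n (zeros_code n \<alpha> S)"
    by (simp add: cyclic_code_def)
qed

text \<open>A code has no common zeros outside its defining set: the set \<open>R\<close> of all
  common zeros is itself coset-closed and cuts out the same code, and the code determines its
  defining set.\<close>

lemma mem_coset_closed_iff:
  assumes "coset_closed CARD('a) n S" "t < n"
  shows "t \<in> S \<longleftrightarrow> (\<forall>v\<in>zeros_code n \<alpha> S. spectrum_at \<alpha> v t = 0)"
proof
  assume zero: "\<forall>v\<in>zeros_code n \<alpha> S. spectrum_at \<alpha> v t = 0"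
  define R where "R = {t. t < n \<and> (\<forall>v\<in>zeros_code n \<alpha> S. spectrum_at \<alpha> v t = 0)}"
  have "coset_closed CARD('a) n R"
    by (auto simp: coset_closed_def R_def n spectrum_at_mod spectrum_at_frobenius)
  moreover have "zeros_code n \<alpha> R = zeros_code n \<alpha> S"
    using assms(1) by (auto simp: zeros_code_def R_def coset_closed_def)
  ultimately have "R = S"
    using defining_set_zeros_code assms(1) by metis
  moreover have "t \<in> R"
    using assms(2) zero by (simp add: R_def)
  ultimately show "t \<in> S"
    by simp
qed (simp add: zeros_code_def)

section \<open>Duals of cyclic codes\<close>

lemma spectrum_at_rotate:
  assumes "u \<in> carrier_vec n"
  shows "\<alpha> ^ (t * l) * spectrum_at \<alpha> (vec n (\<lambda>i. u $ ((i + l) mod n))) t = spectrum_at \<alpha> u t"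
proof -
  \<comment> \<open>The exponent matters only modulo n, so wrapping the index costs nothing and a
    rotation changes the transform by a phase alone.\<close>
  have pow: "\<alpha> ^ (t * ((i + l) mod n)) = \<alpha> ^ (t * l) * \<alpha> ^ (t * i)" for i
    using root_power_mod[of "t * ((i + l) mod n)"] root_power_mod[of "t * (i + l)"]
    by (simp add: mod_mult_right_eq algebra_simps flip: power_add)
  have "\<alpha> ^ (t * l) * spectrum_at \<alpha> (vec n (\<lambda>i. u $ ((i + l) mod n))) t =
      (\<Sum>i<n. to_ac (u $ ((i + l) mod n)) * \<alpha> ^ (t * ((i + l) mod n)))"
    by (simp add: spectrum_at_eq_sum sum_distrib_left pow mult_ac)
  also have "\<dots> = spectrum_at \<alpha> u t"
    using sum_add_mod[OF n, of "\<lambda>i. to_ac (u $ i) * \<alpha> ^ (t * i)" l]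
    by (simp add: spectrum_at_eq_sum assms)
  finally show ?thesis .
qed

lemma root_power_complement:
  assumes "t \<le> n"
  shows "\<alpha> ^ ((n - t) * i) * \<alpha> ^ (t * i) = 1"
proof -
  have "\<alpha> ^ ((n - t) * i) * \<alpha> ^ (t * i) = \<alpha> ^ (n * i)"
    using assms by (simp flip: power_add add_mult_distrib)
  thus ?thesis
    by (simp add: power_mult root_power_n)
qed

text \<open>As -t lies outside \<open>S\<close>, some codeword \<open>u\<close> has nonzero
  transform there. Every rotation of \<open>u\<close> is orthogonal to \<open>v\<close>, and the
  transform of these vanishing correlations at -t is the product of the transforms of
  \<open>u\<close> at -t and of \<open>v\<close> at \<open>t\<close>.\<close>

lemma dual_spectrum_eq_0:
  assumes S: "coset_closed CARD('a) n S"
    and v: "v \<in> dual_code n (zeros_code n \<alpha> S)" and t: "t < n" "(n - t) mod n \<notin> S"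
  shows "spectrum_at \<alpha> v t = 0"
proof -
  have v_carrier: "v \<in> carrier_vec n"
    using v by (simp add: dual_code_def)
  obtain u where u: "u \<in> zeros_code n \<alpha> S" "spectrum_at \<alpha> u (n - t) \<noteq> 0"
    using mem_coset_closed_iff[OF S, of "(n - t) mod n"] t n by (auto simp: spectrum_at_mod)
  hence u_carrier: "u \<in> carrier_vec n"
    by (simp add: zeros_code_def)
  define w where "w l = vec n (\<lambda>i. u $ ((i + l) mod n))" for l
  have "w l \<in> zeros_code n \<alpha> S" for l
    unfolding zeros_code_def
  proof (intro CollectI conjI ballI)
    show "w l \<in> carrier_vec n"
      by (simp add: w_def)
    fix s assume "s \<in> S"
    hence "\<alpha> ^ (s * l) * spectrum_at \<alpha> (w l) s = 0"
      using u(1) spectrum_at_rotate[OF u_carrier] by (simp add: w_def zeros_code_def)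
    thus "spectrum_at \<alpha> (w l) s = 0"
      using root_nonzero by simp
  qed
  hence "w l \<bullet> v = 0" for l
    using v by (simp add: dual_code_def)
  moreover have "w l \<bullet> v = (\<Sum>i<n. u $ ((i + l) mod n) * v $ i)" for l
    using v_carrier by (simp add: scalar_prod_def w_def lessThan_atLeast0)
  ultimately have "to_ac (\<Sum>i<n. u $ ((i + l) mod n) * v $ i) = 0" for l
    by simp
  hence orth: "(\<Sum>i<n. to_ac (u $ ((i + l) mod n)) * to_ac (v $ i)) = 0" for l
    unfolding to_ac_sum to_ac_mult .
  \<comment> \<open>For a fixed coordinate, summing over all shifts gives the transform of a
    rotation of \<open>u\<close>; multiplying by \<alpha>^(ti) inverts its phase.\<close>
  have inner: "(\<Sum>l<n. to_ac (u $ ((i + l) mod n)) * \<alpha> ^ ((n - t) * l)) =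
      spectrum_at \<alpha> u (n - t) * \<alpha> ^ (t * i)" if "i < n" for i
  proof -
    have "spectrum_at \<alpha> u (n - t) =
        \<alpha> ^ ((n - t) * i) * (\<Sum>l<n. to_ac (u $ ((i + l) mod n)) * \<alpha> ^ ((n - t) * l))"
      using spectrum_at_rotate[OF u_carrier, of "n - t" i]
      by (simp add: spectrum_at_eq_sum add.commute)
    thus ?thesis
      using root_power_complement[of t i] t(1) by (simp add: mult_ac)
  qed
  have "0 = (\<Sum>l<n. \<alpha> ^ ((n - t) * l) *
      (\<Sum>i<n. to_ac (u $ ((i + l) mod n)) * to_ac (v $ i)))"
    by (simp add: orth)
  also have "\<dots> = (\<Sum>i<n. to_ac (v $ i) *
      (\<Sum>l<n. to_ac (u $ ((i + l) mod n)) * \<alpha> ^ ((n - t) * l)))"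
    unfolding sum_distrib_left by (subst sum.swap) (simp add: mult_ac)
  also have "\<dots> = (\<Sum>i<n. to_ac (v $ i) * (spectrum_at \<alpha> u (n - t) * \<alpha> ^ (t * i)))"
    by (intro sum.cong) (simp_all add: inner)
  also have "\<dots> = spectrum_at \<alpha> u (n - t) * spectrum_at \<alpha> v t"
    by (simp add: spectrum_at_eq_sum v_carrier sum_distrib_left mult_ac)
  finally show ?thesis
    using u(2) by simp
qed

text \<open>Reversing \<open>v\<close> turns \<open>u \<bullet> v\<close> into the \<open>n\<close>-th coefficient of a product of polynomials; this
  product vanishes at all \<open>n\<close>-th roots of unity and has degree less than \<open>2n\<close>.\<close>

lemma scalar_prod_eq_0_of_spectra:
  assumes u: "u \<in> carrier_vec n" and v: "v \<in> carrier_vec n"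
    and zero: "\<And>t. t < n \<Longrightarrow> spectrum_at \<alpha> u t * spectrum_at \<alpha> v (n - t) = 0"
  shows "u \<bullet> v = 0"
proof -
  let ?M = "Polynomial.monom 1 n - 1 :: 'a poly"
  \<comment> \<open>The exponents n - j run from 1 to n: \<open>w\<close> has no constant term, and
    coefficient n of the product pairs equal indices.\<close>
  define w where "w = (\<Sum>j<n. Polynomial.monom (v $ j) (n - j))"
  have w_eval: "poly (map_poly to_ac w) (\<alpha> ^ t) = spectrum_at \<alpha> v (n - t)" if t: "t < n" for t
  proof -
    \<comment> \<open>Both sides are inverse to \<alpha>^(tj).\<close>
    have "\<alpha> ^ (t * (n - j)) = \<alpha> ^ ((n - t) * j)" if "j < n" for j
      using root_power_complement[of t j] root_power_complement[of j t] t that root_nonzero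
      by (metis less_imp_le mult.commute mult_cancel_right power_eq_0_iff)
    thus ?thesis
      by (simp add: w_def hom_distribs to_ac_hom.map_poly_hom_monom poly_sum poly_monom
          spectrum_at_eq_sum v flip: power_mult)
  qed
  have "linear_factors \<alpha> {..<n} dvd map_poly to_ac (code_poly u * w)"
    using zero by (subst linear_factors_dvd_iff)
      (auto simp: inj_on_root_power hom_distribs w_eval simp flip: spectrum_at_def)
  hence "map_poly to_ac ?M dvd map_poly to_ac (code_poly u * w)"
    by (simp add: linear_factors_lessThan hom_distribs)
  hence "?M dvd code_poly u * w"
    by (rule to_ac_hom.dvd_map_poly_hom_imp_dvd)
  then obtain h where h: "code_poly u * w = ?M * h"
    by (rule dvdE)
  have w_coeff: "Polynomial.coeff w k = (if 0 < k \<and> k \<le> n then v $ (n - k) else 0)" for k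
  proof -
    have "Polynomial.coeff w k = (\<Sum>j<n. if n - j = k then v $ j else 0)"
      by (simp add: w_def coeff_sum)
    also have "\<dots> = (\<Sum>j<n. if 0 < k \<and> k \<le> n \<and> j = n - k then v $ j else 0)"
      by (intro sum.cong) auto
    also have "\<dots> = (if 0 < k \<and> k \<le> n then v $ (n - k) else 0)"
      by auto
    finally show ?thesis .
  qed
  have "Polynomial.degree w \<le> n"
    by (rule degree_le) (simp add: w_coeff)
  hence "Polynomial.degree (?M * h) < n + n"
    using degree_code_poly[OF u n] degree_mult_le[of "code_poly u" w] unfolding h[symmetric] by linarith
  hence "Polynomial.coeff h n = 0"
  proof (cases "h = 0")
    case False
    assume "Polynomial.degree (?M * h) < n + n"
    hence "Polynomial.degree h < n"
      using False monom_minus_1_neq_0[OF n, where 'a='a]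
      by (simp add: degree_mult_eq degree_monom_minus_1 n)
    thus ?thesis
      by (rule coeff_eq_0)
  qed simp
  \<comment> \<open>Coefficient n of (x^n - 1)h is h_0 - h_n. The degree bound gives h_n = 0, and
    the missing constant term of \<open>w\<close> gives h_0 = 0.\<close>
  moreover have M_coeff: "Polynomial.coeff (?M * h) k =
      (if k < n then 0 else Polynomial.coeff h (k - n)) - Polynomial.coeff h k" for k
    by (simp add: left_diff_distrib coeff_monom_mult)
  moreover have "Polynomial.coeff (code_poly u * w) 0 = 0"
    by (simp add: coeff_mult w_coeff)
  ultimately have "Polynomial.coeff (code_poly u * w) n = 0"
    using n by (simp add: h)
  moreover have "Polynomial.coeff (code_poly u * w) n =
      (\<Sum>i\<le>n. if i < n then u $ i * v $ i else 0)"
    unfolding coeff_mult using u by (intro sum.cong) (auto simp: coeff_code_poly w_coeff)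
  moreover have "\<dots> = (\<Sum>i<n. u $ i * v $ i)"
    by (rule sum.mono_neutral_cong_right) auto
  ultimately show ?thesis
    using v by (simp add: scalar_prod_def lessThan_atLeast0)
qed

text \<open>One inclusion is \<open>dual_spectrum_eq_0\<close>. For the other, at each
  \<open>t\<close> either \<open>t\<close> lies in \<open>S\<close> and \<open>u\<close> has
  transform 0 there, or \<open>v\<close> has transform 0 at -t, so all products of spectra
  vanish.\<close>

lemma dual_zeros_code:
  assumes S: "coset_closed CARD('a) n S"
  shows "dual_code n (zeros_code n \<alpha> S) = zeros_code n \<alpha> {t. t < n \<and> (n - t) mod n \<notin> S}"
proof (intro equalityI subsetI)
  fix v assume v: "v \<in> dual_code n (zeros_code n \<alpha> S)"
  hence "v \<in> carrier_vec n"
    by (simp add: dual_code_def)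
  thus "v \<in> zeros_code n \<alpha> {t. t < n \<and> (n - t) mod n \<notin> S}"
    using dual_spectrum_eq_0[OF S v] by (simp add: zeros_code_def)
next
  fix v assume v: "v \<in> zeros_code n \<alpha> {t. t < n \<and> (n - t) mod n \<notin> S}"
  have "u \<bullet> v = 0" if u: "u \<in> zeros_code n \<alpha> S" for u
  proof (rule scalar_prod_eq_0_of_spectra)
    fix t assume t: "t < n"
    have "(n - (n - t) mod n) mod n = t"
      using t by (cases "t = 0") auto
    hence "spectrum_at \<alpha> v ((n - t) mod n) = 0" if "t \<notin> S"
      using v that n by (auto simp: zeros_code_def)
    thus "spectrum_at \<alpha> u t * spectrum_at \<alpha> v (n - t) = 0"
      using u by (cases "t \<in> S") (auto simp: zeros_code_def spectrum_at_mod)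
  qed (use u v in \<open>auto simp: zeros_code_def\<close>)
  thus "v \<in> dual_code n (zeros_code n \<alpha> S)"
    using v by (simp add: dual_code_def zeros_code_def)
qed

end

section \<open>The Euclidean construction of subsystem codes\<close>

lemma zero_in_linear_code: "linear_code n C \<Longrightarrow> 0\<^sub>v n \<in> C"
  by (simp add: linear_code_iff)

text \<open>Pairs with one zero half separate the two coordinates. If some inner product were
  nonzero, scaling the codeword would turn it into an element of nonzero trace.\<close>

lemma symplectic_dual_times:
  fixes C :: "'a::finite_field vec set"
  assumes C: "linear_code n C"
  shows "symplectic_dual n (C \<times> C) = dual_code n C \<times> dual_code n C"
proof (intro equalityI subsetI)
  have C_carrier: "C \<subseteq> carrier_vec n" and smult: "\<And>c u. u \<in> C \<Longrightarrow> c \<cdot>\<^sub>v u \<in> C"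
    using C by (auto simp: linear_code_iff)
  fix v assume "v \<in> symplectic_dual n (C \<times> C)"
  then obtain x y where v: "v = (x, y)" and xy: "x \<in> carrier_vec n" "y \<in> carrier_vec n"
    and tr: "\<And>a b. a \<in> C \<Longrightarrow> b \<in> C \<Longrightarrow> prime_trace (x \<bullet> b - a \<bullet> y) = 0"
    by (auto simp: symplectic_dual_def trace_symplectic_def)
  obtain e :: 'a where e: "prime_trace e \<noteq> 0"
    using prime_trace_nonzero .
  have "u \<bullet> x = 0" if u: "u \<in> C" for u
  proof (rule ccontr)
    assume nz: "u \<bullet> x \<noteq> 0"
    have u_carrier: "u \<in> carrier_vec n"
      using u C_carrier by blast
    let ?c = "e / (u \<bullet> x)"
    have "x \<bullet> (?c \<cdot>\<^sub>v u) - 0\<^sub>v n \<bullet> y = e"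
      using nz xy u_carrier by (simp add: comm_scalar_prod[of x n u])
    thus False
      using tr[OF zero_in_linear_code[OF C] smult[OF u, of ?c]] e by simp
  qed
  moreover have "u \<bullet> y = 0" if u: "u \<in> C" for u
  proof (rule ccontr)
    assume nz: "u \<bullet> y \<noteq> 0"
    have u_carrier: "u \<in> carrier_vec n"
      using u C_carrier by blast
    \<comment> \<open>The sign compensates for the minus in the symplectic form.\<close>
    let ?c = "- e / (u \<bullet> y)"
    have "x \<bullet> 0\<^sub>v n - (?c \<cdot>\<^sub>v u) \<bullet> y = e"
      using nz xy u_carrier by simp
    thus False
      using tr[OF smult[OF u, of ?c] zero_in_linear_code[OF C]] e by simp
  qed
  ultimately show "v \<in> dual_code n C \<times> dual_code n C"
    using v xy by (simp add: dual_code_def)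
next
  fix v assume v: "v \<in> dual_code n C \<times> dual_code n C"
  have "fst v \<bullet> b = 0" if "b \<in> C" for b
  proof -
    have "fst v \<bullet> b = b \<bullet> fst v"
      using v that C by (intro comm_scalar_prod) (auto simp: dual_code_def linear_code_iff)
    with v that show ?thesis
      by (auto simp: dual_code_def)
  qed
  thus "v \<in> symplectic_dual n (C \<times> C)"
    using v by (auto simp: symplectic_dual_def trace_symplectic_def dual_code_def)
qed

lemma linear_code_times_subgroup:
  fixes C :: "'a::field vec set"
  assumes C: "linear_code n C"
  shows "subgroup (C \<times> C) (monoid_vec TYPE('a) n \<times>\<times> monoid_vec TYPE('a) n)"
proof -
  let ?G = "monoid_vec TYPE('a) n"
  interpret comm_group ?G
    by (rule comm_group_vec)
  have "subgroup C ?G"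
  proof (rule subgroupI)
    fix u assume u: "u \<in> C"
    hence u_carrier: "u \<in> carrier_vec n"
      using C by (auto simp: linear_code_iff)
    have "inv\<^bsub>?G\<^esub> u = (- 1) \<cdot>\<^sub>v u"
      using u_carrier by (intro inv_equality) (auto simp: monoid_vec_def)
    thus "inv\<^bsub>?G\<^esub> u \<in> C"
      using u C by (simp add: linear_code_iff)
  qed (use C in \<open>auto simp: linear_code_iff monoid_vec_def\<close>)
  thus ?thesis
    using DirProd_subgroups is_group by blast
qed

text \<open>A pair outside C x C has a component outside \<open>C\<close>, whose Hamming weight is
  no larger; conversely a vector padded with zero keeps its weight. Non-inclusion keeps both sets
  nonempty, so that \<open>Min\<close> is meaningful.\<close>

lemma min_symplectic_weight_times_diff:
  fixes A C :: "'a::finite_field vec set"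
  assumes A: "linear_code n A" and C: "linear_code n C" and ne: "\<not> A \<subseteq> C"
  shows "min_symplectic_weight n (A \<times> A - C \<times> C) = min_weight (A - C)"
proof -
  have A_carrier: "A \<subseteq> carrier_vec n" and zero: "0\<^sub>v n \<in> A" "0\<^sub>v n \<in> C"
    using A C by (auto simp: linear_code_iff)
  let ?P = "A \<times> A - C \<times> C - {(0\<^sub>v n, 0\<^sub>v n)}" and ?Q = "{v \<in> A - C. v \<noteq> 0\<^sub>v (dim_vec v)}"
  have fin: "finite A"
    using A_carrier finite_carrier_vec by (rule finite_subset)
  \<comment> \<open>The zero vector lies in \<open>C\<close>, so it is already excluded.\<close>
  have Q: "?Q = A - C"
    using A_carrier zero(2) by auto
  have le: "hamming_weight v \<le> symplectic_weight (x, y)"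
    if "x \<in> A" "y \<in> A" "v = x \<or> v = y" for x y v
  proof -
    have "x \<in> carrier_vec n" "y \<in> carrier_vec n"
      using that A_carrier by blast+
    thus ?thesis
      unfolding hamming_weight_def symplectic_weight_def
      using that(3) by (intro card_mono) auto
  qed
  have eq: "symplectic_weight (v, 0\<^sub>v n) = hamming_weight v" if "v \<in> A" for v
  proof -
    have "v \<in> carrier_vec n"
      using that A_carrier by blast
    thus ?thesis
      unfolding hamming_weight_def symplectic_weight_def by (intro arg_cong[of _ _ card]) auto
  qed
  have "Min (symplectic_weight ` ?P) = Min (hamming_weight ` ?Q)"
  proof (rule antisym)
    have "Min (hamming_weight ` ?Q) \<in> hamming_weight ` ?Q"
      unfolding Q using fin ne by (intro Min_in) auto
    then obtain v where v: "v \<in> A - C" "Min (hamming_weight ` ?Q) = hamming_weight v"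
      unfolding Q by auto
    have "hamming_weight v \<in> symplectic_weight ` ?P"
      using v(1) zero eq[of v] by (intro image_eqI[of _ _ "(v, 0\<^sub>v n)"]) auto
    thus "Min (symplectic_weight ` ?P) \<le> Min (hamming_weight ` ?Q)"
      unfolding v(2) using fin by (intro Min_le) auto
  next
    obtain v where v: "v \<in> A - C"
      using ne by blast
    have "Min (symplectic_weight ` ?P) \<in> symplectic_weight ` ?P"
      using fin v zero by (intro Min_in) auto
    then obtain x y where xy: "(x, y) \<in> ?P" "Min (symplectic_weight ` ?P) = symplectic_weight (x, y)"
      by auto
    then obtain w where w: "w \<in> A - C" "w = x \<or> w = y"
      by blast
    have "Min (hamming_weight ` ?Q) \<le> hamming_weight w"
      using fin w(1) unfolding Q by simp
    also have "\<dots> \<le> symplectic_weight (x, y)"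
      using xy(1) w(2) by (intro le) auto
    finally show "Min (hamming_weight ` ?Q) \<le> Min (symplectic_weight ` ?P)"
      by (simp add: xy(2))
  qed
  thus ?thesis
    by (simp add: min_symplectic_weight_def min_weight_def)
qed

lemma subsystem_code_of_linear_code:
  fixes C D :: "'a::finite_field vec set"
  assumes C: "linear_code n C" and D: "linear_code n D" "C \<inter> dual_code n C = D"
    and dual: "linear_code n (dual_code n D)"
    and card_C: "card C = CARD('a) ^ (k + r)" and card_D: "card D = CARD('a) ^ k"
    and card_dual: "card (dual_code n D) = CARD('a) ^ (n - k)"
    and r: "r < n - 2 * k"
  shows "subsystem_code_nkrd TYPE('a) n (n - 2 * k - r) r (min_weight (dual_code n D - C))"
proof -
  let ?q = "CARD('a)" and ?U = "C \<times> C"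
  have q: "?q > 1"
    by (rule CARD_finite_field_gt_1)
  have W: "?U \<inter> symplectic_dual n ?U = D \<times> D"
    using D(2) by (auto simp: symplectic_dual_times[OF C])
  have finC: "finite C"
    using C finite_carrier_vec finite_subset by (auto simp: linear_code_iff)
  \<comment> \<open>The range of \<open>r\<close> makes \<open>C\<close> smaller than the dual of
    \<open>D\<close>, which selects the set-difference branch of the distance.\<close>
  have "k + r < n - k"
    using r by linarith
  hence "card C < card (dual_code n D)"
    using q by (simp add: card_C card_dual)
  hence not_sub: "\<not> dual_code n D \<subseteq> C"
    using card_mono[OF finC] by (metis leD)
  have dual_W: "symplectic_dual n (D \<times> D) = dual_code n D \<times> dual_code n D"
    by (rule symplectic_dual_times[OF D(1)])
  have ne: "dual_code n D \<times> dual_code n D \<noteq> ?U"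
    using not_sub zero_in_linear_code[OF C] zero_in_linear_code[OF dual] by blast
  \<comment> \<open>The bound on \<open>r\<close> makes these truncated subtractions exact; the
    identities are the two cardinality conditions in exponent form.\<close>
  have exp: "n + r = (n - 2 * k - r) + ((k + r) + (k + r))"
    "n = (n - 2 * k - r + r) + (k + k)"
    using r by linarith+
  have "card ?U * ?q ^ (n - 2 * k - r) = ?q ^ n * ?q ^ r"
    by (simp add: card_cartesian_product card_C flip: power_add) (use exp(1) in \<open>simp add: add_ac\<close>)
  hence card_U: "real (card ?U) = real (?q ^ n * ?q ^ r) / real (?q ^ (n - 2 * k - r))"
    using q by (simp add: field_simps flip: of_nat_mult of_nat_power)
  have "card (D \<times> D) * (?q ^ (n - 2 * k - r) * ?q ^ r) = ?q ^ n"
    by (simp add: card_cartesian_product card_D flip: power_add) (use exp(2) in \<open>simp add: add_ac\<close>)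
  hence card_W: "real (card (D \<times> D)) = real (?q ^ n) / real (?q ^ (n - 2 * k - r) * ?q ^ r)"
    using q by (simp add: field_simps flip: of_nat_mult of_nat_power)
  show ?thesis
    unfolding subsystem_code_nkrd_def subsystem_code_exists_def
  proof (intro conjI exI[of _ ?U])
    show "subgroup ?U (monoid_vec TYPE('a) n \<times>\<times> monoid_vec TYPE('a) n)"
      by (rule linear_code_times_subgroup[OF C])
  next
    show "let W = ?U \<inter> symplectic_dual n ?U in
      real (card ?U) = real (?q ^ n * ?q ^ r) / real (?q ^ (n - 2 * k - r)) \<and>
      real (card W) = real (?q ^ n) / real (?q ^ (n - 2 * k - r) * ?q ^ r) \<and>
      min_weight (dual_code n D - C) =
        (if symplectic_dual n W = ?U then min_symplectic_weight n (symplectic_dual n W)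
         else min_symplectic_weight n (symplectic_dual n W - ?U))"
      unfolding Let_def W dual_W if_not_P[OF ne]
        min_symplectic_weight_times_diff[OF dual C not_sub]
      using card_U card_W by blast
  qed (use q in auto)
qed

theorem proposition5:
  fixes n k r :: nat
    and \<alpha> :: "'a::finite_field alg_closure"
    and D :: "'a vec set"
    and T T_C :: "nat set"
  assumes "n > 0"
    and "coprime n CARD('a)"
    and "primitive_root_of_unity n \<alpha>"
    and "cyclic_code n D"
    and "code_dim n D = k"
    and "D \<subseteq> dual_code n D"
    and "T \<subseteq> defining_set n \<alpha> D - defining_set n \<alpha> (dual_code n D)"
    and "union_of_cosets CARD('a) n T"
    and "T_C = defining_set n \<alpha> D - (T \<union> set_multiple n (- 1) T)"
    and "r = card (T \<union> set_multiple n (- 1) T)"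
  shows "(\<exists>!C. cyclic_code n C \<and> defining_set n \<alpha> C = T_C) \<and>
         (\<forall>C d. cyclic_code n C \<and> defining_set n \<alpha> C = T_C \<and> r < n - 2 * k \<and>
                d = min_weight (dual_code n D - C) \<longrightarrow>
                subsystem_code_nkrd TYPE('a) n (n - 2 * k - r) r d)"
proof -
  let ?q = "CARD('a)" and ?Z = "zeros_code n \<alpha>"
  let ?neg = "\<lambda>S. {t. t < n \<and> (n - t) mod n \<in> S}"
  let ?dual = "\<lambda>S. {t. t < n \<and> (n - t) mod n \<notin> S}"
  note root = assms(1-3)
  define T_D where "T_D = defining_set n \<alpha> D"
  define T' where "T' = T \<union> set_multiple n (- 1) T"
  have T_D: "coset_closed ?q n T_D" and D_eq: "D = ?Z T_D"
    unfolding T_D_def using coset_closed_defining_set[OF root assms(4)]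
      cyclic_code_eq_zeros_code[OF root assms(4)] by auto
  have T: "coset_closed ?q n T"
    using union_of_cosets_coset_closed assms(1,8) .
  have neg_T: "set_multiple n (- 1) T = ?neg T"
    using set_multiple_minus_1 assms(1) T by (simp add: coset_closed_def)
  have T': "coset_closed ?q n T'"
    unfolding T'_def neg_T by (intro coset_closed_Un T coset_closed_negative assms(1))
  have T_C: "coset_closed ?q n T_C"
    unfolding assms(9) T_D_def[symmetric] T'_def[symmetric]
    by (intro coset_closed_Diff[OF assms(2)] T_D T')
  have invol: "(n - (n - t) mod n) mod n = t" if "t < n" for t
    using that by (cases "t = 0") auto
  have dual_closed: "coset_closed ?q n (?dual S)" if "coset_closed ?q n S" for S
  proof -
    \<comment> \<open>The defining set of the dual is the complement of the negated set.\<close>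
    have "coset_closed ?q n ({..<n} - ?neg S)"
      by (intro coset_closed_Diff[OF assms(2)] coset_closed_negative that assms(1))
        (use assms(1) in \<open>auto simp: coset_closed_def\<close>)
    moreover have "{..<n} - ?neg S = ?dual S"
      by auto
    ultimately show ?thesis
      by simp
  qed
  have dual_eq: "dual_code n (?Z S) = ?Z (?dual S)" if "coset_closed ?q n S" for S
    by (rule dual_zeros_code[OF root that])
  have def_dual: "defining_set n \<alpha> (dual_code n D) = ?dual T_D"
    unfolding D_eq dual_eq[OF T_D] by (rule defining_set_zeros_code[OF root dual_closed[OF T_D]])
  \<comment> \<open>Self-orthogonality makes each such frequency a common zero of \<open>D\<close>,
    and all common zeros lie in \<open>T_D\<close>.\<close>
  have dual_sub: "?dual T_D \<subseteq> T_D"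
  proof
    fix t assume t: "t \<in> ?dual T_D"
    hence "\<forall>v\<in>D. spectrum_at \<alpha> v t = 0"
      using assms(6) unfolding D_eq dual_eq[OF T_D] by (auto simp: zeros_code_def)
    thus "t \<in> T_D"
      using mem_coset_closed_iff[OF root T_D] t unfolding D_eq by blast
  qed
  \<comment> \<open>Avoiding the defining set of the dual means exactly that -t lies in
    \<open>T_D\<close>.\<close>
  have T_sub: "t \<in> T_D" "(n - t) mod n \<in> T_D" "t < n" if "t \<in> T" for t
    using that assms(7) T unfolding T_D_def[symmetric] def_dual by (auto simp: coset_closed_def)
  have T'_sub: "T' \<subseteq> T_D"
    using T_sub invol unfolding T'_def neg_T by fastforce
  have T'_neg: "(n - t) mod n \<in> T' \<longleftrightarrow> t \<in> T'" if "t < n" for t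
    using that invol[OF that] T_sub(3) assms(1) unfolding T'_def neg_T by auto
  have T_C_eq: "T_C = T_D - T'"
    by (simp add: assms(9) T_D_def T'_def)
  \<comment> \<open>Removing \<open>T'\<close> from \<open>T_D\<close> adds the negatives of
    \<open>T'\<close> to the dual's defining set, and these are \<open>T'\<close> itself by
    symmetry.\<close>
  have "?dual T_C = ?dual T_D \<union> T'"
    using T'_neg T' unfolding T_C_eq by (auto simp: coset_closed_def)
  hence union: "T_C \<union> ?dual T_C = T_D"
    using dual_sub T'_sub unfolding T_C_eq by auto
  have fin: "finite T_D" "finite T'"
    using T_D T' by (auto simp: coset_closed_def intro: finite_subset)
  have card_T_D_le: "card T_D \<le> n"
    using card_mono[of "{..<n}" T_D] T_D by (simp add: coset_closed_def)
  have q: "?q > 1"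
    by (rule CARD_finite_field_gt_1)
  have linear_D: "linear_code n D"
    using assms(4) by (simp add: cyclic_code_def)
  \<comment> \<open>Two counts of \<open>D\<close>, by defining set and by dimension, are
    compared.\<close>
  have "?q ^ (n - card T_D) = ?q ^ k"
    using card_linear_code[OF linear_D] card_zeros_code[OF root T_D] assms(5) D_eq by simp
  hence k: "n - card T_D = k"
    using q by simp
  have unique: "C = ?Z T_C" if "cyclic_code n C" "defining_set n \<alpha> C = T_C" for C
    using cyclic_code_eq_zeros_code[OF root that(1)] that(2) by simp
  show ?thesis
  proof (intro conjI allI impI)
    show "\<exists>!C. cyclic_code n C \<and> defining_set n \<alpha> C = T_C"
      using cyclic_zeros_code[OF root T_C] defining_set_zeros_code[OF root T_C] unique by blast
  next
    fix C d
    assume C: "cyclic_code n C \<and> defining_set n \<alpha> C = T_C \<and> r < n - 2 * k \<and>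
        d = min_weight (dual_code n D - C)"
    hence C_eq: "C = ?Z T_C"
      using unique by blast
    have r: "r = card T'"
      by (simp add: assms(10) T'_def)
    have card_T': "card T' \<le> card T_D"
      using card_mono[OF fin(1) T'_sub] .
    have "card T_C = card T_D - card T'"
      unfolding T_C_eq using fin(2) T'_sub by (rule card_Diff_subset)
    hence card_C: "card C = ?q ^ (k + r)"
      unfolding C_eq card_zeros_code[OF root T_C] using k r card_T' card_T_D_le
      by (intro arg_cong[of _ _ "\<lambda>m. ?q ^ m"]) linarith
    have card_D: "card D = ?q ^ k"
      using card_linear_code[OF linear_D] assms(5) by simp
    \<comment> \<open>Negation matches the dual's defining set with the complement of
      \<open>T_D\<close>, so it has k elements.\<close>
    have "bij_betw (\<lambda>t. (n - t) mod n) (?dual T_D) ({..<n} - T_D)"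
      by (rule bij_betwI[of _ _ _ "\<lambda>t. (n - t) mod n"]) (use invol assms(1) in auto)
    hence "card (?dual T_D) = n - card T_D"
      using card_Diff_subset[OF fin(1), of "{..<n}"] T_D
      by (simp add: bij_betw_same_card coset_closed_def)
    hence card_dual: "card (dual_code n D) = ?q ^ (n - k)"
      unfolding D_eq dual_eq[OF T_D] card_zeros_code[OF root dual_closed[OF T_D]] using k by simp
    have "C \<inter> dual_code n C = ?Z (T_C \<union> ?dual T_C)"
      unfolding C_eq dual_eq[OF T_C] by (auto simp: zeros_code_def)
    hence inter: "C \<inter> dual_code n C = D"
      unfolding union D_eq[symmetric] .
    have "linear_code n (dual_code n D)"
      using cyclic_zeros_code[OF root dual_closed[OF T_D]]
      unfolding D_eq dual_eq[OF T_D] cyclic_code_def by blast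
    moreover have "linear_code n C"
      using C by (simp add: cyclic_code_def)
    ultimately show "subsystem_code_nkrd TYPE('a) n (n - 2 * k - r) r d"
      using subsystem_code_of_linear_code[OF _ linear_D inter _ card_C card_D card_dual] C by blast
  qed
qed

end
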